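(* Let $f\colon X\to X$ be a $\lambda$-ergodic interval exchange transformation, $X=[0,b)$, where $\lambda$ is Lebesgue measure. If $\psi(t)>0$ for some $t\in(0,b)$, then the induced interval exchange transformation $f_t\colon X_t\to X_t$, $X_t=[0,t)$, is weakly mixing (relative to Lebesgue measure).
   Context: An interval exchange transformation (IET) is a pair $(X,f)$ where $X=[0,b)\subset\mathbb{R}$ is a bounded interval ($b>0$) and $f\colon X\to X$ is a right continuous bijection with a finite set $D$ of discontinuities such that $f'(x)=1$ for all $x\in X\setminus D$. Write $D=\{d_1<\dots<d_{r-1}\}$, $r\ge2$, $d_0=0$, $d_r=b$ (so $0,b\notin D$), and $D_0=D\cup\{0,b\}=\{d_k\}_{k=0}^r$. For $x\in X$ and $n\ge1$ set $$\rho(x)=\min_{0\le k\le r}|x-d_k|,\qquad \rho_n(x)=\min_{-n\le k\le n-1}\rho(f^k(x)),$$ $$\Delta_n(x)=\min_{\substack{|p|,|q|\le n\\ p\ne q}}|f^p(x)-f^q(x)|,\qquad \rho'_n(x)=\min\big(\rho_n(x),\tfrac12\Delta_n(x)\big),$$ ($p,q$ integers) and $\psi(x)=\limsup_{n\to\infty} n\,\rho'_n(x)$. For $0<t<b$, $f_t$ is the first return map of $f$ to $X_t=[0,t)$: $f_t(x)=f^{n(x)}(x)$ with $n(x)=\min\{n\ge1: f^n(x)\in X_t\}$. Weak mixing of $f_t$ is with respect to (normalized) Lebesgue measure restricted to $X_t$. *)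

theory Defs
  imports "HOL-Probability.Probability"
begin

text \<open>
  An interval exchange transformation of \<open>X = [0,b)\<close> is given by \<open>b\<close> and a map
  \<open>f :: real \<Rightarrow> real\<close> of which only the values on \<open>{0..<b}\<close> matter. Continuity and
  differentiability are those of a map on \<open>X\<close>; in particular they are one-sided at \<open>0\<close>.
\<close>

definition discontinuities :: "real \<Rightarrow> (real \<Rightarrow> real) \<Rightarrow> real set" where
  "discontinuities b f = {x \<in> {0..<b}. \<not> continuous (at x within {0..<b}) f}"

text \<open>Nonemptiness of the set of discontinuities is the convention that \<open>r \<ge> 2\<close> intervals
  are exchanged.\<close>

definition iet :: "real \<Rightarrow> (real \<Rightarrow> real) \<Rightarrow> bool" where
  "iet b f \<longleftrightarrow>
     0 < b \<and>
     bij_betw f {0..<b} {0..<b} \<and>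
     (\<forall>x\<in>{0..<b}. continuous (at_right x) f) \<and>
     finite (discontinuities b f) \<and>
     discontinuities b f \<noteq> {} \<and>
     (\<forall>x \<in> {0..<b} - discontinuities b f.
        (f has_real_derivative 1) (at x within {0..<b}))"

definition int_iterate :: "real \<Rightarrow> (real \<Rightarrow> real) \<Rightarrow> int \<Rightarrow> real \<Rightarrow> real" where
  "int_iterate b f k =
     (if 0 \<le> k then f ^^ nat k else inv_into {0..<b} f ^^ nat (- k))"

definition rho :: "real \<Rightarrow> (real \<Rightarrow> real) \<Rightarrow> real \<Rightarrow> real" where
  "rho b f x = Min ((\<lambda>d. \<bar>x - d\<bar>) ` (discontinuities b f \<union> {0, b}))"

text \<open>The following minima are over nonempty sets only for \<open>n \<ge> 1\<close>; the value at
  \<open>n = 0\<close> is irrelevant for \<open>psi\<close>.\<close>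

definition rho_n :: "real \<Rightarrow> (real \<Rightarrow> real) \<Rightarrow> nat \<Rightarrow> real \<Rightarrow> real" where
  "rho_n b f n x = Min ((\<lambda>k. rho b f (int_iterate b f k x)) ` {- int n .. int n - 1})"

definition Delta_n :: "real \<Rightarrow> (real \<Rightarrow> real) \<Rightarrow> nat \<Rightarrow> real \<Rightarrow> real" where
  "Delta_n b f n x =
     Min {\<bar>int_iterate b f p x - int_iterate b f q x\<bar> | p q.
            \<bar>p\<bar> \<le> int n \<and> \<bar>q\<bar> \<le> int n \<and> p \<noteq> q}"

definition rho'_n :: "real \<Rightarrow> (real \<Rightarrow> real) \<Rightarrow> nat \<Rightarrow> real \<Rightarrow> real" where
  "rho'_n b f n x = min (rho_n b f n x) (1 / 2 * Delta_n b f n x)"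

definition psi :: "real \<Rightarrow> (real \<Rightarrow> real) \<Rightarrow> real \<Rightarrow> ereal" where
  "psi b f x = limsup (\<lambda>n. ereal (real n * rho'_n b f n x))"

definition first_return_map :: "(real \<Rightarrow> real) \<Rightarrow> real \<Rightarrow> real \<Rightarrow> real" where
  "first_return_map f t x = (f ^^ (LEAST n. 1 \<le> n \<and> (f ^^ n) x \<in> {0..<t})) x"

definition measure_preserving_map :: "'a measure \<Rightarrow> ('a \<Rightarrow> 'a) \<Rightarrow> bool" where
  "measure_preserving_map M T \<longleftrightarrow> T \<in> measurable M M \<and> distr M M T = M"

definition ergodic :: "'a measure \<Rightarrow> ('a \<Rightarrow> 'a) \<Rightarrow> bool" where
  "ergodic M T \<longleftrightarrow>
     measure_preserving_map M T \<and>
     (\<forall>A\<in>sets M. T -` A \<inter> space M = A \<longrightarrow>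
        emeasure M A = 0 \<or> emeasure M (space M - A) = 0)"

text \<open>Here \<open>M\<close> is meant to be a probability measure.\<close>

definition weakly_mixing :: "'a measure \<Rightarrow> ('a \<Rightarrow> 'a) \<Rightarrow> bool" where
  "weakly_mixing M T \<longleftrightarrow>
     measure_preserving_map M T \<and>
     (\<forall>A\<in>sets M. \<forall>B\<in>sets M.
        (\<lambda>n. (\<Sum>k<n. \<bar>measure M ((T ^^ k) -` A \<inter> B) - measure M A * measure M B\<bar>) / real n)
          \<longlonglongrightarrow> 0)"

definition leb_on :: "real \<Rightarrow> real measure" where
  "leb_on b = restrict_space lebesgue {0..<b}"

definition normalized_leb_on :: "real \<Rightarrow> real measure" where
  "normalized_leb_on t = uniform_measure (leb_on t) {0..<t}"

end

theory Submission imports Defs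
begin

text \<open>
  Let \<open>Y = [0,t)\<close> and let \<open>T\<close> be the map induced by \<open>f\<close> on \<open>Y\<close>. It suffices that \<open>T \<times> T\<close> is
  ergodic: ergodic averages of the rectangles \<open>A \<times> A\<close> then control the averages of the squared
  correlations of \<open>T\<close> (\<open>weakly_mixing_if_ergodic_square\<close>). The sections of an invariant set of
  \<open>T \<times> T\<close> play the part of an eigenfunction of \<open>T\<close>, with values in the subsets of \<open>Y\<close> and the action
  of \<open>T\<close> on these in the place of an eigenvalue.

  Let \<open>E\<close> be a \<open>T \<times> T\<close>-invariant subset of \<open>Y \<times> Y\<close>. Its sections \<open>E\<^sub>y\<close> satisfy
  \<open>T\<^sup>-\<^sup>1 E\<^bsub>Ty\<^esub> = E\<^sub>y\<close>. They extend to a family of subsets of \<open>Y\<close> indexed by all of \<open>X = [0,b)\<close>: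
  the section at \<open>y\<close> is the one at the first point of the forward \<open>f\<close>-orbit of \<open>y\<close> that lies
  in \<open>Y\<close>. In a step of \<open>f\<close> from a point outside \<open>Y\<close> the section of the extended family is unchanged,
  and in a step from a point of \<open>Y\<close> it is moved by the measure preserving \<open>T\<close>. The rule changes at \<open>t\<close>
  only, and the proof looks at the two sides of \<open>t\<close>.

  Positivity of \<open>psi\<close> at \<open>t\<close> supplies, for infinitely many \<open>n\<close>, a radius \<open>r \<ge> c / n\<close> such that
  the intervals of radius \<open>r\<close> about \<open>f\<^sup>k t\<close>, \<open>\<bar>k\<bar> \<le> n\<close>, are disjoint and are carried each to the
  next by \<open>f\<close> through translations (\<open>rho'_n_tower\<close>). Compare on each level the sections at \<open>y\<close> and at \<open>y + r\<close>,
  where \<open>y\<close> is in the left half. Since no level but the one at \<open>k = 0\<close> contains \<open>t\<close>, the distance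
  is the same on all levels \<open>k \<le> 0\<close> and the same on all levels \<open>k \<ge> 1\<close>; in between, exactly one of
  the two points lies in \<open>Y\<close>, so that only one of the two sections is moved by \<open>T\<close>. The
  triangle inequality bounds the defect \<open>P(y) = \<mu>(E\<^sub>y \<triangle> T\<^sup>-\<^sup>1 E\<^sub>y)\<close> at the right half of the base by the
  sum of the two distances (\<open>defect_le_tower_sum\<close>). The total of the distances over the tower
  tends to \<open>0\<close> with \<open>r\<close>, because translation is continuous in measure (\<open>small_shift_diff\<close>). But \<open>P\<close>
  is \<open>f\<close>-invariant, so that unless \<open>P\<close> vanishes almost everywhere it exceeds some \<open>q > 0\<close> almost
  everywhere, and then this total is at least \<open>n r q \<ge> c q\<close>. Hence \<open>P = 0\<close> almost everywhere
  (\<open>defect_zero\<close>): almost every section of \<open>E\<close> is \<open>T\<close>-invariant, hence trivial by ergodicity of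
  \<open>T\<close>, and the measure of the section is itself a \<open>T\<close>-invariant function of \<open>y\<close>. So \<open>E\<close> is
  trivial (\<open>trivial_if_defect_zero\<close>).
\<close>

section \<open>Ergodicity and invariant sets\<close>

lemma measure_preserving_funpow:
  assumes "measure_preserving_map M T"
  shows "measure_preserving_map M (T ^^ k)"
proof (induction k)
  case 0
  then show ?case by (simp add: measure_preserving_map_def id_def)
next
  case (Suc k)
  have T: "T \<in> measurable M M" "distr M M T = M"
    and Tk: "T ^^ k \<in> measurable M M" "distr M M (T ^^ k) = M"
    using assms Suc by (auto simp: measure_preserving_map_def)
  have "distr M M (T ^^ Suc k) = distr (distr M M (T ^^ k)) M T"
    by (simp only: distr_distr[OF T(1) Tk(1)] funpow.simps)
  also have "\<dots> = M"
    unfolding Tk(2) by (rule T(2))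
  finally have "distr M M (T ^^ Suc k) = M" .
  moreover have "T ^^ Suc k \<in> measurable M M"
    unfolding funpow.simps by (rule measurable_comp[OF Tk(1) T(1)])
  ultimately show ?case
    unfolding measure_preserving_map_def by blast
qed

lemma measure_preserving_AE:
  assumes "measure_preserving_map M T" "AE x in M. P x"
  shows "AE x in M. P (T x)"
proof -
  have "distr M M T = M"
    using assms by (simp add: measure_preserving_map_def)
  with assms(2) have "AE x in distr M M T. P x"
    by (rule_tac subst[where P="\<lambda>N. AE x in N. P x"]) auto
  then show ?thesis
    using assms by (intro AE_distrD[of T M M]) (auto simp: measure_preserving_map_def)
qed

lemma measure_preserving_emeasure_vimage:
  assumes "measure_preserving_map M T" "A \<in> sets M"
  shows "emeasure M (T -` A \<inter> space M) = emeasure M A"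
  using assms emeasure_distr[of T M M A] by (simp add: measure_preserving_map_def)

lemma ergodic_dichotomy:
  assumes "ergodic M T" "{x \<in> space M. P x} \<in> sets M" "\<And>x. x \<in> space M \<Longrightarrow> P (T x) \<longleftrightarrow> P x"
  shows "(AE x in M. P x) \<or> (AE x in M. \<not> P x)"
proof -
  let ?A = "{x \<in> space M. P x}"
  have "T \<in> measurable M M"
    using assms(1) by (simp add: ergodic_def measure_preserving_map_def)
  then have "T -` ?A \<inter> space M = ?A"
    using assms(3) by (auto dest: measurable_space)
  then have "emeasure M ?A = 0 \<or> emeasure M (space M - ?A) = 0"
    using assms(1,2) by (auto simp: ergodic_def)
  moreover have "space M - ?A = {x \<in> space M. \<not> P x}" by auto
  moreover have "{x \<in> space M. \<not> P x} \<in> sets M"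
    using sets.Diff[OF sets.top assms(2)] \<open>space M - ?A = _\<close> by simp
  ultimately show ?thesis
    using assms(2) by (auto simp: AE_iff_measurable[OF _ refl])
qed

text \<open>
  The set of points that visit \<open>A\<close> infinitely often is invariant without exceptions, and it agrees
  with \<open>A\<close> almost everywhere when \<open>A\<close> is invariant up to a null set.
\<close>

lemma ergodic_dichotomy_AE:
  assumes "ergodic M T" "A \<in> sets M" "AE x in M. T x \<in> A \<longleftrightarrow> x \<in> A"
  shows "(AE x in M. x \<in> A) \<or> (AE x in M. x \<notin> A)"
proof -
  have mp: "measure_preserving_map M T" and [measurable]: "T \<in> measurable M M" "A \<in> sets M"
    using assms by (auto simp: ergodic_def measure_preserving_map_def)
  have [measurable]: "T ^^ k \<in> measurable M M" for k
    using measure_preserving_funpow[OF mp] by (simp add: measure_preserving_map_def)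
  let ?P = "\<lambda>x. \<exists>\<^sub>F k in sequentially. (T ^^ k) x \<in> A"
  have "AE x in M. (T ^^ k) (T x) \<in> A \<longleftrightarrow> (T ^^ k) x \<in> A" for k
    using measure_preserving_AE[OF measure_preserving_funpow[OF mp, of k] assms(3)]
    by (simp add: funpow_swap1)
  then have "AE x in M. \<forall>k. (T ^^ k) (T x) \<in> A \<longleftrightarrow> (T ^^ k) x \<in> A"
    by (simp add: AE_all_countable)
  then have P_iff: "AE x in M. ?P x \<longleftrightarrow> x \<in> A"
  proof eventually_elim
    case (elim x)
    have "(T ^^ k) x \<in> A \<longleftrightarrow> x \<in> A" for k
      by (induction k) (use elim in \<open>simp_all add: funpow_swap1\<close>)
    then show ?case by simp
  qed
  have "{x \<in> space M. ?P x} \<in> sets M"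
    unfolding frequently_sequentially by measurable
  moreover have "?P (T x) \<longleftrightarrow> ?P x" for x
  proof -
    have "?P (T x) \<longleftrightarrow> (\<exists>\<^sub>F k in sequentially. (T ^^ Suc k) x \<in> A)"
      by (simp add: funpow_swap1)
    also have "\<dots> \<longleftrightarrow> ?P x"
      unfolding frequently_def eventually_sequentially_Suc[of "\<lambda>k. (T ^^ k) x \<notin> A"] ..
    finally show ?thesis .
  qed
  ultimately have "(AE x in M. ?P x) \<or> (AE x in M. \<not> ?P x)"
    by (intro ergodic_dichotomy[OF assms(1)]) auto
  then show ?thesis
  proof
    assume "AE x in M. ?P x"
    then have "AE x in M. x \<in> A" using P_iff by eventually_elim simp
    then show ?thesis ..
  next
    assume "AE x in M. \<not> ?P x"
    then have "AE x in M. x \<notin> A" using P_iff by eventually_elim simp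
    then show ?thesis ..
  qed
qed

section \<open>Averages along orbits\<close>

lemma sets_vimage_Int_sets:
  assumes "f \<in> measurable M N" "A \<in> sets N" "B \<in> sets M"
  shows "f -` A \<inter> B \<in> sets M"
proof -
  have "f -` A \<inter> B = (f -` A \<inter> space M) \<inter> B"
    using sets.sets_into_space[OF assms(3)] by auto
  then show ?thesis using assms by (metis measurable_sets sets.Int)
qed

definition visit_average :: "('a \<Rightarrow> 'a) \<Rightarrow> 'a set \<Rightarrow> nat \<Rightarrow> 'a \<Rightarrow> real" where
  "visit_average T A n x = (\<Sum>k<n. indicator A ((T ^^ k) x)) / real n"

lemma visit_average_bounds: "0 \<le> visit_average T A n x" "visit_average T A n x \<le> 1"
proof -
  have "(\<Sum>k<n. indicator A ((T ^^ k) x)) \<le> (\<Sum>k<n. 1::real)"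
    by (intro sum_mono) (auto simp: indicator_def)
  then show "visit_average T A n x \<le> 1"
    by (cases "n = 0") (auto simp: visit_average_def field_simps)
qed (auto simp: visit_average_def intro!: divide_nonneg_nonneg sum_nonneg)

lemma limsup_visit_average_invariant:
  "limsup (\<lambda>n. ereal (visit_average T A n (T x))) = limsup (\<lambda>n. ereal (visit_average T A n x))"
proof -
  let ?a = "\<lambda>n. visit_average T A n x" and ?b = "\<lambda>n. visit_average T A n (T x)"
  let ?d = "\<lambda>n. ?b n - ?a (Suc n)"
  have bound: "norm (?d n) \<le> 1 / real (Suc n)" for n
  proof (cases "n = 0")
    case True
    then show ?thesis
      by (auto simp: visit_average_def indicator_def)
  next
    case False
    define s :: real where "s = (\<Sum>k<n. indicator A ((T ^^ k) (T x)))"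
    have s: "0 \<le> s" "s \<le> n"
      using visit_average_bounds[of T A n "T x"] False by (auto simp: visit_average_def s_def field_simps)
    have "(\<Sum>k<Suc n. indicator A ((T ^^ k) x)) = indicator A x + s"
      by (simp add: sum.lessThan_Suc_shift s_def funpow_swap1 del: sum.lessThan_Suc)
    then have "?d n = s / n - (indicator A x + s) / Suc n"
      by (simp add: visit_average_def s_def)
    also have "\<dots> = (s / n - indicator A x) / Suc n"
      using False by (simp add: field_simps)
    moreover have "\<bar>s / n - indicator A x\<bar> \<le> 1"
    proof -
      have "0 \<le> s / n" "s / n \<le> 1" using s False by (auto simp: field_simps)
      then show ?thesis by (auto simp: indicator_def)
    qed
    ultimately show ?thesis
      by (simp add: divide_right_mono)
  qed
  have "?d \<longlonglongrightarrow> 0"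
    by (rule Lim_null_comparison[OF always_eventually LIMSEQ_Suc[OF lim_1_over_n]]) (use bound in auto)
  then have d: "(\<lambda>n. ereal (?d n)) \<longlonglongrightarrow> ereal 0"
    by simp
  have "limsup (\<lambda>n. ereal (?b n)) = limsup (\<lambda>n. ereal (?d n) + ereal (?a (Suc n)))"
    by simp
  also have "\<dots> = 0 + limsup (\<lambda>n. ereal (?a (Suc n)))"
    using ereal_limsup_lim_add[OF d, of "\<lambda>n. ereal (?a (Suc n))"] by (simp add: zero_ereal_def)
  also have "\<dots> = limsup (\<lambda>n. ereal (?a n))"
    using limsup_shift[of "\<lambda>n. ereal (?a n)"] by simp
  finally show ?thesis .
qed

text \<open>
  An orbit segment of length \<open>N\<close> is cut greedily into blocks: a point of \<open>A\<close> is a block of length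
  \<open>1\<close>, any other point starts a block of length at most \<open>m\<close> on which \<open>A\<close> is visited with frequency
  at least \<open>c\<close>. Only a final piece of length at most \<open>m\<close> is left uncovered.
\<close>

lemma greedy_visit_count:
  fixes c :: real
  assumes "0 \<le> c" "c \<le> 1"
    and *: "\<And>k. (T ^^ k) x \<in> A \<or> (\<exists>n\<in>{1..m}. c \<le> visit_average T A n ((T ^^ k) x))"
  shows "c * (real N - real m) \<le> (\<Sum>k<N. indicator A ((T ^^ k) x))"
  using *
proof (induction N arbitrary: x rule: less_induct)
  case (less N)
  let ?s = "\<lambda>N x. \<Sum>k<N. indicator A ((T ^^ k) x) :: real"
  have split: "?s (n + l) x = ?s n x + ?s l ((T ^^ n) x)" for n l
    by (induction l) (simp_all add: funpow_add add.commute[of n])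
  have IH: "c * (real N' - real m) \<le> ?s N' ((T ^^ n) x)" if "N' < N" for N' n
    using less.prems[of "_ + n"] by (intro less.IH[OF that]) (simp add: funpow_add)
  show ?case
  proof (cases "N \<le> m")
    case True
    then have "c * (real N - real m) \<le> 0"
      using assms by (simp add: mult_nonneg_nonpos)
    also have "\<dots> \<le> ?s N x" by (intro sum_nonneg) auto
    finally show ?thesis .
  next
    case False
    from less.prems[of 0] consider "x \<in> A"
      | n where "1 \<le> n" "n \<le> m" "c \<le> visit_average T A n x" by auto
    then obtain n where n: "1 \<le> n" "n \<le> N" "c * n \<le> ?s n x"
    proof cases
      case 1
      then show ?thesis using assms False by (intro that[of 1]) auto
    next
      case 2
      then show ?thesis using False by (intro that[of n]) (auto simp: visit_average_def field_simps)
    qed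
    have "c * (real (N - n) - real m) \<le> ?s (N - n) ((T ^^ n) x)"
      using n by (intro IH) auto
    then show ?thesis
      using n split[of n "N - n"] by (simp add: algebra_simps of_nat_diff)
  qed
qed

text \<open>
  The upper half of Birkhoff's theorem for indicator functions. If the limit superior of the averages
  exceeded \<open>c' > \<mu>(A)\<close> it would do so almost everywhere by ergodicity. Adding to \<open>A\<close> the few points that
  have to wait longer than \<open>m\<close> for an average above \<open>c'\<close> gives a set \<open>A'\<close>, still of measure below
  \<open>c'\<close>, to which the greedy cutting applies at every point; integrating that bound yields
  \<open>\<mu>(A') \<ge> c'\<close>.
\<close>

lemma (in prob_space) visit_average_eventually_less:
  assumes erg: "ergodic M T" and A[measurable]: "A \<in> sets M" and c: "prob A < c"
  shows "AE x in M. \<forall>\<^sub>F n in sequentially. visit_average T A n x < c"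
proof -
  have mp: "measure_preserving_map M T" and [measurable]: "T \<in> measurable M M"
    using erg by (auto simp: ergodic_def measure_preserving_map_def)
  have Tk[measurable]: "T ^^ k \<in> measurable M M" for k
    using measure_preserving_funpow[OF mp] by (simp add: measure_preserving_map_def)
  have [measurable]: "visit_average T A n \<in> borel_measurable M" for n
    unfolding visit_average_def by measurable
  obtain c' where c': "prob A < c'" "c' < c" using dense[OF c] by auto
  let ?P = "\<lambda>x. limsup (\<lambda>n. ereal (visit_average T A n x)) \<le> ereal c'"
  have "(AE x in M. ?P x) \<or> (AE x in M. \<not> ?P x)"
    by (intro ergodic_dichotomy[OF erg]) (simp_all add: limsup_visit_average_invariant)
  moreover have "\<not> (AE x in M. \<not> ?P x)"
  proof
    assume notP: "AE x in M. \<not> ?P x"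
    define U where "U m = {x \<in> space M. \<exists>n\<in>{1..m}. c' \<le> visit_average T A n x}" for m :: nat
    have [measurable]: "U m \<in> sets M" for m unfolding U_def by measurable
    have ex: "AE x in M. \<exists>n\<ge>1. c' < visit_average T A n x"
      using notP
    proof eventually_elim
      case (elim x)
      show ?case
      proof (rule ccontr)
        assume "\<not> ?case"
        then have "\<forall>\<^sub>F n in sequentially. ereal (visit_average T A n x) \<le> ereal c'"
          by (auto simp: eventually_sequentially not_less intro!: exI[of _ 1])
        then have "?P x" by (rule Limsup_bounded)
        then show False using elim by simp
      qed
    qed
    then have "AE x in M. c' < 1"
    proof eventually_elim
      case (elim x)
      then obtain n where "c' < visit_average T A n x" by blast
      then show ?case using visit_average_bounds(2)[of T A n x] by linarith
    qed
    then have c1: "c' \<le> 1" by simp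
    have c0: "0 \<le> c'" using c' measure_nonneg[of M A] by linarith
    have "(\<lambda>m. prob (U m)) \<longlonglongrightarrow> prob (\<Union>m. U m)"
    proof (rule finite_Lim_measure_incseq)
      show "incseq U"
      proof (rule incseq_SucI)
        fix m show "U m \<subseteq> U (Suc m)" unfolding U_def by force
      qed
    qed auto
    moreover have "prob (\<Union>m. U m) = 1"
    proof (rule prob_eq_1[THEN iffD2])
      show "AE x in M. x \<in> (\<Union>m. U m)"
        using ex AE_space
      proof eventually_elim
        case (elim x)
        then obtain n where "1 \<le> n" "c' < visit_average T A n x" by blast
        then have "x \<in> U n" using elim by (auto simp: U_def intro!: bexI[of _ n])
        then show ?case by blast
      qed
    qed auto
    ultimately have "(\<lambda>m. prob (U m)) \<longlonglongrightarrow> 1" by simp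
    then have "\<forall>\<^sub>F m in sequentially. 1 - (c' - prob A) < prob (U m)"
      using c' by (intro order_tendstoD) auto
    then obtain m where m: "1 - (c' - prob A) < prob (U m)"
      by (auto simp: eventually_sequentially)
    define A' where "A' = A \<union> (space M - U m)"
    have [measurable]: "A' \<in> sets M" unfolding A'_def by measurable
    have "prob A' \<le> prob A + prob (space M - U m)"
      unfolding A'_def by (intro measure_Un_le) auto
    then have A'_less: "prob A' < c'"
      using m prob_compl[of "U m"] by simp
    have greedy: "c' * (real N - real m) \<le> (\<Sum>k<N. indicator A' ((T ^^ k) x))"
      if x: "x \<in> space M" for x N
    proof (rule greedy_visit_count[OF c0 c1])
      fix k
      have "visit_average T A n y \<le> visit_average T A' n y" for n y
        unfolding visit_average_def
        by (intro divide_right_mono sum_mono) (auto simp: A'_def indicator_def)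
      moreover have "(T ^^ k) x \<in> space M" using measurable_space[OF Tk x] .
      ultimately show "(T ^^ k) x \<in> A' \<or> (\<exists>n\<in>{1..m}. c' \<le> visit_average T A' n ((T ^^ k) x))"
        unfolding A'_def U_def by (blast intro: order_trans)
    qed
    have int: "expectation (\<lambda>x. indicator A' ((T ^^ k) x)) = prob A'" for k
    proof -
      have "expectation (\<lambda>x. indicator A' ((T ^^ k) x)) = integral\<^sup>L (distr M M (T ^^ k)) (indicator A' :: 'a \<Rightarrow> real)"
        by (rule integral_distr[symmetric]) auto
      then show ?thesis
        using measure_preserving_funpow[OF mp] by (simp add: measure_preserving_map_def)
    qed
    have "c' * (real N - real m) \<le> N * prob A'" for N
    proof -
      have "expectation (\<lambda>x. c' * (real N - real m)) \<le> expectation (\<lambda>x. \<Sum>k<N. indicator A' ((T ^^ k) x))"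
      proof (rule integral_mono)
        show "integrable M (\<lambda>x. \<Sum>k<N. indicator A' ((T ^^ k) x) :: real)"
          by (intro Bochner_Integration.integrable_sum integrable_const_bound[where B=1])
            (auto simp: indicator_def)
      qed (use greedy in auto)
      also have "\<dots> = (\<Sum>k<N. expectation (\<lambda>x. indicator A' ((T ^^ k) x)))"
        by (intro Bochner_Integration.integral_sum integrable_const_bound[where B=1]) (auto simp: indicator_def)
      finally show ?thesis by (simp add: int prob_space)
    qed
    then have bnd: "real N * (c' - prob A') \<le> c' * m" for N by (simp add: algebra_simps)
    \<comment> \<open>The additive error of the greedy count is negligible for long orbit segments.\<close>
    obtain N where "c' * m < real N * (c' - prob A')"
      using reals_Archimedean3[of "c' - prob A'"] A'_less by auto
    then show False using bnd[of N] by simp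
  qed
  ultimately have "AE x in M. ?P x" by blast
  then show ?thesis
  proof eventually_elim
    case (elim x)
    then have "limsup (\<lambda>n. ereal (visit_average T A n x)) < ereal c"
      using c' by (auto intro: le_less_trans)
    then show ?case
      by (auto dest: Limsup_lessD)
  qed
qed

text \<open>
  The lower bound for \<open>A\<close> is the upper bound for its complement.
\<close>

lemma (in prob_space) visit_average_tendsto:
  assumes erg: "ergodic M T" and A[measurable]: "A \<in> sets M"
  shows "AE x in M. (\<lambda>n. visit_average T A n x) \<longlonglongrightarrow> prob A"
proof -
  have mp: "measure_preserving_map M T"
    using erg by (auto simp: ergodic_def)
  have Tk[measurable]: "T ^^ k \<in> measurable M M" for k
    using measure_preserving_funpow[OF mp] by (simp add: measure_preserving_map_def)
  have up: "AE x in M. \<forall>\<^sub>F n in sequentially. visit_average T A n x < prob A + 1 / Suc j" for j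
    by (intro visit_average_eventually_less erg) auto
  have low: "AE x in M. \<forall>\<^sub>F n in sequentially. prob A - 1 / Suc j < visit_average T A n x" for j
  proof -
    have "AE x in M. \<forall>\<^sub>F n in sequentially. visit_average T (space M - A) n x < 1 - prob A + 1 / Suc j"
      by (intro visit_average_eventually_less erg) (auto simp: prob_compl)
    then show ?thesis using AE_space
    proof eventually_elim
      case (elim x)
      show ?case
        using elim(1) eventually_gt_at_top[of 0]
      proof eventually_elim
        case n: (elim n)
        have "(T ^^ k) x \<in> space M" for k using measurable_space[OF Tk elim(2)] .
        then have "visit_average T (space M - A) n x = (\<Sum>k<n. 1 - indicator A ((T ^^ k) x)) / n"
          unfolding visit_average_def by (intro arg_cong2[where f="(/)"] sum.cong) (auto simp: indicator_def)
        also have "\<dots> = 1 - visit_average T A n x"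
          using n by (simp add: sum_subtractf visit_average_def diff_divide_distrib)
        finally show ?case using n by simp
      qed
    qed
  qed
  have "AE x in M. \<forall>j. (\<forall>\<^sub>F n in sequentially. visit_average T A n x < prob A + 1 / Suc j) \<and>
      (\<forall>\<^sub>F n in sequentially. prob A - 1 / Suc j < visit_average T A n x)"
    unfolding AE_all_countable using up low by (auto intro: AE_conjI)
  then show ?thesis
  proof eventually_elim
    case (elim x)
    show ?case
    proof (rule LIMSEQ_I)
      fix e :: real assume "0 < e"
      then obtain j where j: "inverse (real (Suc j)) < e" using reals_Archimedean by blast
      have "\<forall>\<^sub>F n in sequentially. norm (visit_average T A n x - prob A) < e"
        using elim[rule_format, THEN conjunct1, of j] elim[rule_format, THEN conjunct2, of j]
        by eventually_elim (use j in \<open>auto simp: inverse_eq_divide abs_if\<close>)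
      then show "\<exists>no. \<forall>n\<ge>no. norm (visit_average T A n x - prob A) < e"
        by (simp add: eventually_sequentially)
    qed
  qed
qed

lemma (in prob_space) ergodic_correlation_average:
  assumes erg: "ergodic M T" and A[measurable]: "A \<in> sets M" and B[measurable]: "B \<in> sets M"
  shows "(\<lambda>n. (\<Sum>k<n. prob ((T ^^ k) -` A \<inter> B)) / real n) \<longlonglongrightarrow> prob A * prob B"
proof -
  have mp: "measure_preserving_map M T"
    using erg by (auto simp: ergodic_def)
  have Tk[measurable]: "T ^^ k \<in> measurable M M" for k
    using measure_preserving_funpow[OF mp] by (simp add: measure_preserving_map_def)
  have [measurable]: "visit_average T A n \<in> borel_measurable M" for n
    unfolding visit_average_def by measurable
  have "(\<lambda>n. \<integral>x. visit_average T A n x * indicator B x \<partial>M) \<longlonglongrightarrow> (\<integral>x. prob A * indicator B x \<partial>M)"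
  proof (rule integral_dominated_convergence[where w="\<lambda>_. 1"])
    show "AE x in M. (\<lambda>n. visit_average T A n x * indicator B x) \<longlonglongrightarrow> prob A * indicator B x"
      using visit_average_tendsto[OF erg A] by eventually_elim (intro tendsto_intros)
    show "AE x in M. norm (visit_average T A n x * indicator B x) \<le> 1" for n
      using visit_average_bounds[of T A n] by (auto simp: indicator_def)
  qed auto
  moreover have "(\<integral>x. visit_average T A n x * indicator B x \<partial>M)
      = (\<Sum>k<n. prob ((T ^^ k) -` A \<inter> B)) / real n" for n
  proof -
    have "(\<integral>x. visit_average T A n x * indicator B x \<partial>M)
      = (\<integral>x. (\<Sum>k<n. indicator ((T ^^ k) -` A \<inter> B) x) / real n \<partial>M)"
    proof (rule Bochner_Integration.integral_cong[OF refl])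
      fix x
      have "indicator ((T ^^ k) -` A \<inter> B) x = indicator A ((T ^^ k) x) * (indicator B x :: real)" for k
        by (simp add: indicator_def)
      then show "visit_average T A n x * indicator B x = (\<Sum>k<n. indicator ((T ^^ k) -` A \<inter> B) x) / real n"
        by (simp add: visit_average_def sum_distrib_right)
    qed
    also have "\<dots> = (\<Sum>k<n. \<integral>x. indicator ((T ^^ k) -` A \<inter> B) x \<partial>M) / real n"
    proof -
      have m: "(T ^^ k) -` A \<inter> B \<in> sets M" for k
        by (rule sets_vimage_Int_sets[OF Tk A B])
      show ?thesis
        using m by (subst integral_divide_zero, subst Bochner_Integration.integral_sum)
          (auto simp: integrable_indicator_iff emeasure_eq_measure)
    qed
    also have "\<dots> = (\<Sum>k<n. prob ((T ^^ k) -` A \<inter> B)) / real n"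
    proof -
      have "(T ^^ k) -` A \<inter> B \<inter> space M = (T ^^ k) -` A \<inter> B" for k
        using sets.sets_into_space[OF B] by auto
      then show ?thesis by simp
    qed
    finally show ?thesis .
  qed
  ultimately show ?thesis
    by simp
qed

section \<open>Weak mixing from ergodicity of the square\<close>

lemma abs_average_tendsto_0:
  fixes x :: "nat \<Rightarrow> real"
  assumes "(\<lambda>n. (\<Sum>k<n. (x k)\<^sup>2) / real n) \<longlonglongrightarrow> 0"
  shows "(\<lambda>n. (\<Sum>k<n. \<bar>x k\<bar>) / real n) \<longlonglongrightarrow> 0"
proof (rule Lim_null_comparison[OF always_eventually])
  show "(\<lambda>n. sqrt ((\<Sum>k<n. (x k)\<^sup>2) / real n)) \<longlonglongrightarrow> 0"
    using tendsto_real_sqrt[OF assms] by simp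
  show "\<forall>n. norm ((\<Sum>k<n. \<bar>x k\<bar>) / real n) \<le> sqrt ((\<Sum>k<n. (x k)\<^sup>2) / real n)"
  proof
    fix n
    have "(\<Sum>k<n. \<bar>x k\<bar>)\<^sup>2 \<le> (\<Sum>k<n. \<bar>x k\<bar>\<^sup>2) * real n"
      using sum_squared_le_sum_of_squares[of "\<lambda>k. \<bar>x k\<bar>" "{..<n}"] by simp
    then have "((\<Sum>k<n. \<bar>x k\<bar>) / real n)\<^sup>2 \<le> (\<Sum>k<n. (x k)\<^sup>2) / real n"
      by (cases "n = 0") (auto simp: power2_eq_square field_simps)
    then show "norm ((\<Sum>k<n. \<bar>x k\<bar>) / real n) \<le> sqrt ((\<Sum>k<n. (x k)\<^sup>2) / real n)"
      by (intro real_le_rsqrt) (simp add: sum_nonneg)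
  qed
qed

lemma measure_preserving_map_prod:
  assumes "sigma_finite_measure M" and mp: "measure_preserving_map M T"
  shows "measure_preserving_map (M \<Otimes>\<^sub>M M) (map_prod T T)"
proof -
  have T: "T \<in> measurable M M" "distr M M T = M"
    using mp unfolding measure_preserving_map_def by blast+
  have eq: "map_prod T T = (\<lambda>(x, y). (T x, T y))" by (simp add: fun_eq_iff)
  have "distr (M \<Otimes>\<^sub>M M) (M \<Otimes>\<^sub>M M) (map_prod T T) = distr M M T \<Otimes>\<^sub>M distr M M T"
    unfolding eq using assms(1) T by (intro pair_measure_distr[symmetric]) simp_all
  moreover have "map_prod T T \<in> measurable (M \<Otimes>\<^sub>M M) (M \<Otimes>\<^sub>M M)"
    unfolding eq using T(1) by measurable
  ultimately show ?thesis
    unfolding measure_preserving_map_def T(2) by blast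
qed

text \<open>
  With \<open>a\<^sub>k = \<mu>(T\<^sup>-\<^sup>k A \<inter> B)\<close>, the averages of \<open>a\<^sub>k\<^sup>2\<close> and of \<open>a\<^sub>k \<mu>(A)\<close> are ergodic averages of
  \<open>A \<times> A\<close> against \<open>B \<times> B\<close> and against \<open>B \<times> X\<close>. Expanding the square,
  \<open>(a\<^sub>k - \<mu>(A) \<mu>(B))\<^sup>2\<close> tends to \<open>0\<close> on average, and Cauchy-Schwarz passes to absolute values.
\<close>

lemma (in prob_space) weakly_mixing_if_ergodic_square:
  assumes mp: "measure_preserving_map M T"
    and erg: "ergodic (M \<Otimes>\<^sub>M M) (map_prod T T)"
  shows "weakly_mixing M T"
  unfolding weakly_mixing_def
proof (intro conjI ballI mp)
  fix A B assume A[measurable]: "A \<in> sets M" and B[measurable]: "B \<in> sets M"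
  interpret P: pair_prob_space M M ..
  have Tk[measurable]: "T ^^ k \<in> measurable M M" for k
    using measure_preserving_funpow[OF mp] by (simp add: measure_preserving_map_def)
  define a where "a k = prob ((T ^^ k) -` A \<inter> B)" for k
  have measure_times: "P.prob (C \<times> D) = prob C * prob D" if "C \<in> sets M" "D \<in> sets M" for C D
    using that by (simp add: measure_def emeasure_pair_measure_Times enn2real_mult)
  have funpow_map: "map_prod T T ^^ k = map_prod (T ^^ k) (T ^^ k)" for k
    by (induction k) (auto simp: fun_eq_iff)
  have vim: "(T ^^ k) -` A \<inter> C \<in> sets M" if "C \<in> sets M" for k C
    by (rule sets_vimage_Int_sets[OF Tk A that])
  have rect: "P.prob ((map_prod T T ^^ k) -` (A \<times> A) \<inter> (C \<times> D))
      = prob ((T ^^ k) -` A \<inter> C) * prob ((T ^^ k) -` A \<inter> D)" if "C \<in> sets M" "D \<in> sets M" for k C D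
  proof -
    have "(map_prod T T ^^ k) -` (A \<times> A) \<inter> (C \<times> D) = ((T ^^ k) -` A \<inter> C) \<times> ((T ^^ k) -` A \<inter> D)"
      by (auto simp: funpow_map)
    then show ?thesis using vim that by (simp add: measure_times)
  qed
  have "(\<lambda>n. (\<Sum>k<n. a k * a k) / real n) \<longlonglongrightarrow> (prob A * prob A) * (prob B * prob B)"
    using P.ergodic_correlation_average[OF erg, of "A \<times> A" "B \<times> B"]
    by (simp add: rect a_def measure_times)
  moreover have "prob ((T ^^ k) -` A \<inter> space M) = prob A" for k
    using measure_preserving_emeasure_vimage[OF measure_preserving_funpow[OF mp] A]
    by (simp add: measure_def)
  then have "(\<lambda>n. (\<Sum>k<n. a k * prob A) / real n) \<longlonglongrightarrow> (prob A * prob A) * prob B"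
    using P.ergodic_correlation_average[OF erg, of "A \<times> A" "B \<times> space M"]
    by (simp add: rect a_def measure_times prob_space)
  ultimately have "(\<lambda>n. (\<Sum>k<n. a k * a k) / real n - 2 * prob B * ((\<Sum>k<n. a k * prob A) / real n)
       + (prob A * prob B)\<^sup>2) \<longlonglongrightarrow>
      (prob A * prob A) * (prob B * prob B) - 2 * prob B * ((prob A * prob A) * prob B) + (prob A * prob B)\<^sup>2"
    by (intro tendsto_intros)
  also have "(prob A * prob A) * (prob B * prob B) - 2 * prob B * ((prob A * prob A) * prob B) + (prob A * prob B)\<^sup>2 = 0"
    by (simp add: power2_eq_square)
  finally have "(\<lambda>n. (\<Sum>k<n. (a k - prob A * prob B)\<^sup>2) / real n) \<longlonglongrightarrow> 0"
  proof (rule Lim_transform_eventually)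
    show "\<forall>\<^sub>F n in sequentially. (\<Sum>k<n. a k * a k) / real n - 2 * prob B * ((\<Sum>k<n. a k * prob A) / real n)
       + (prob A * prob B)\<^sup>2 = (\<Sum>k<n. (a k - prob A * prob B)\<^sup>2) / real n"
      using eventually_gt_at_top[of 0]
    proof eventually_elim
      case (elim n)
      have "(\<Sum>k<n. (a k - prob A * prob B)\<^sup>2) =
          (\<Sum>k<n. a k * a k) - 2 * prob B * (\<Sum>k<n. a k * prob A) + n * (prob A * prob B)\<^sup>2"
        by (simp add: power2_diff sum.distrib sum_subtractf sum_distrib_left power2_eq_square algebra_simps)
      then show ?case using elim by (simp add: field_simps)
    qed
  qed
  then show "(\<lambda>n. (\<Sum>k<n. \<bar>prob ((T ^^ k) -` A \<inter> B) - prob A * prob B\<bar>) / real n) \<longlonglongrightarrow> 0"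
    unfolding a_def by (rule abs_average_tendsto_0)
qed

section \<open>First return maps\<close>

definition return_map :: "('a \<Rightarrow> 'a) \<Rightarrow> 'a set \<Rightarrow> 'a \<Rightarrow> 'a" where
  "return_map f Y x = (f ^^ (LEAST n. 1 \<le> n \<and> (f ^^ n) x \<in> Y)) x"

text \<open>
  The first point in \<open>Y\<close> of the forward orbit, the starting point included. The value \<open>c\<close> for orbits that
  avoid \<open>Y\<close> makes the map total and measurable into \<open>Y\<close>; such orbits form an \<open>f\<close>-invariant set
  outside \<open>Y\<close>, so that any constant respects the two step equations below.
\<close>

definition entry_map :: "('a \<Rightarrow> 'a) \<Rightarrow> 'a set \<Rightarrow> 'a \<Rightarrow> 'a \<Rightarrow> 'a" where
  "entry_map f Y c x = (if \<exists>j. (f ^^ j) x \<in> Y then (f ^^ (LEAST j. (f ^^ j) x \<in> Y)) x else c)"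

lemma entry_map_inside: "x \<in> Y \<Longrightarrow> entry_map f Y c x = x"
  unfolding entry_map_def by (auto simp: Least_eq_0 dest: spec[of _ 0])

lemma entry_map_step_outside:
  assumes "x \<notin> Y"
  shows "entry_map f Y c (f x) = entry_map f Y c x"
proof (cases "\<exists>j. (f ^^ j) x \<in> Y")
  case True
  then obtain j where j: "(f ^^ j) x \<in> Y" by auto
  then have "(LEAST j. (f ^^ j) x \<in> Y) = Suc (LEAST j. (f ^^ Suc j) x \<in> Y)"
    using assms by (intro Least_Suc) auto
  moreover have "\<exists>j. (f ^^ Suc j) x \<in> Y"
    using j assms by (cases j) auto
  ultimately show ?thesis
    using True unfolding entry_map_def by (simp add: funpow_swap1)
next
  case False
  then have "(f ^^ Suc j) x \<notin> Y" for j by blast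
  with False show ?thesis
    unfolding entry_map_def by (simp add: funpow_swap1)
qed

lemma entry_map_step_inside:
  assumes "\<exists>n\<ge>1. (f ^^ n) x \<in> Y"
  shows "entry_map f Y c (f x) = return_map f Y x"
proof -
  obtain n where n: "1 \<le> n" "(f ^^ n) x \<in> Y" using assms by auto
  then have "(LEAST n. 1 \<le> n \<and> (f ^^ n) x \<in> Y) = Suc (LEAST j. 1 \<le> Suc j \<and> (f ^^ Suc j) x \<in> Y)"
    by (intro Least_Suc) auto
  moreover have "\<exists>j. (f ^^ Suc j) x \<in> Y"
    using n by (cases n) auto
  ultimately show ?thesis
    unfolding entry_map_def return_map_def by (simp add: funpow_swap1)
qed

lemma measurable_funpow [measurable (raw)]:
  "f \<in> measurable M M \<Longrightarrow> f ^^ n \<in> measurable M M"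
proof (induction n)
  case (Suc n)
  then show ?case unfolding funpow.simps by (auto intro: measurable_comp)
qed (simp add: id_def)

lemma measurable_entry_map:
  assumes f[measurable]: "f \<in> measurable M M" and Y[measurable]: "Y \<in> sets M" and c: "c \<in> Y"
  shows "entry_map f Y c \<in> measurable M (restrict_space M Y)"
proof (rule measurable_restrict_space2)
  have "c \<in> space M" using sets.sets_into_space[OF Y] c by auto
  have "(\<lambda>x. (f ^^ (LEAST j. (f ^^ j) x \<in> Y)) x) \<in> measurable M M"
    by (rule measurable_compose_countable) measurable
  moreover have "(\<lambda>_. c) \<in> measurable M M" using \<open>c \<in> space M\<close> by simp
  ultimately show "entry_map f Y c \<in> measurable M M"
    unfolding entry_map_def[abs_def] by measurable
  show "entry_map f Y c \<in> space M \<rightarrow> Y"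
    using c unfolding entry_map_def by (auto intro: LeastI)
qed

text \<open>
  For \<open>A \<subseteq> Y\<close>, let \<open>R n\<close> be the points whose first entry to \<open>Y\<close> is at time \<open>n\<close>
  and in \<open>A\<close>, and \<open>Q n\<close> the points of \<open>Y\<close> whose first return is at time \<open>n + 1\<close> and in \<open>A\<close>. Then
  \<open>f\<^sup>-\<^sup>1 (R n)\<close> is the disjoint union of \<open>R (n + 1)\<close> and \<open>Q n\<close>, so that \<open>\<mu>(A)\<close> telescopes into
  \<open>\<mu>(Q 0) + \<mu>(Q 1) + \<dots>\<close>; the remainder \<open>\<mu>(R n)\<close> vanishes because the \<open>R n\<close> are disjoint.
  Returning is demanded of every point, since the map must send \<open>Y\<close> into itself.
\<close>

lemma return_map_measure_preserving:
  assumes "finite_measure M" and mp: "measure_preserving_map M f" and Y[measurable]: "Y \<in> sets M"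
    and "Y \<noteq> {}" and return: "\<And>x. x \<in> Y \<Longrightarrow> \<exists>n\<ge>1. (f ^^ n) x \<in> Y"
  shows "measure_preserving_map (restrict_space M Y) (return_map f Y)"
proof -
  interpret finite_measure M by fact
  let ?N = "restrict_space M Y" and ?T = "return_map f Y"
  have f[measurable]: "f \<in> measurable M M" using mp by (simp add: measure_preserving_map_def)
  have YM: "Y \<subseteq> space M" using sets.sets_into_space[OF Y] .
  have spN: "space ?N = Y" using YM by (auto simp: space_restrict_space)
  obtain c where c: "c \<in> Y" using \<open>Y \<noteq> {}\<close> by auto
  have "(\<lambda>x. entry_map f Y c (f x)) \<in> measurable ?N ?N"
    using measurable_compose[OF measurable_restrict_space1[OF f] measurable_entry_map[OF f Y c]] .
  then have T: "?T \<in> measurable ?N ?N"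
    by (rule measurable_cong[THEN iffD1, rotated]) (simp add: spN, rule entry_map_step_inside, rule return)
  have "measure M (?T -` A \<inter> Y) = measure M A" if A[measurable]: "A \<in> sets M" and AY: "A \<subseteq> Y" for A
  proof -
    define R where "R n = {x \<in> space M. (\<forall>i<n. (f ^^ i) x \<notin> Y) \<and> (f ^^ n) x \<in> A}" for n
    define Q where "Q n = {x \<in> Y. (\<forall>i<n. (f ^^ Suc i) x \<notin> Y) \<and> (f ^^ Suc n) x \<in> A}" for n
    have R[measurable]: "R n \<in> sets M" for n unfolding R_def by measurable
    have "Q n = Y \<inter> {x \<in> space M. (\<forall>i<n. (f ^^ Suc i) x \<notin> Y) \<and> (f ^^ Suc n) x \<in> A}" for n
      using YM by (auto simp: Q_def)
    also have "\<dots> n \<in> sets M" for n by measurable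
    finally have Q[measurable]: "Q n \<in> sets M" for n .
    have step: "measure M (R n) = measure M (R (Suc n)) + measure M (Q n)" for n
    proof -
      have *: "f -` R n \<inter> space M = R (Suc n) \<union> Q n"
        using YM measurable_space[OF f]
        by (auto simp: R_def Q_def funpow_swap1 less_Suc_eq_0_disj)
      have "measure M (R n) = measure M (f -` R n \<inter> space M)"
        using measure_preserving_emeasure_vimage[OF mp, of "R n"] by (simp add: measure_def)
      also have "\<dots> = measure M (R (Suc n)) + measure M (Q n)"
        unfolding * by (intro finite_measure_Union) (auto simp: R_def Q_def)
      finally show ?thesis .
    qed
    have sum: "(\<Sum>i<n. measure M (Q i)) = measure M A - measure M (R n)" for n
    proof (induction n)
      case 0
      have "R 0 = A" using AY YM by (auto simp: R_def)
      then show ?case by simp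
    next
      case (Suc n)
      then show ?case using step[of n] by simp
    qed
    have "disjoint_family R"
    proof -
      have "R m \<inter> R n = {}" if "m < n" for m n
        using that AY by (auto simp: R_def)
      then show ?thesis
        unfolding disjoint_family_on_def by (metis Int_commute linorder_neqE_nat)
    qed
    then have "(\<lambda>n. measure M (R n)) \<longlonglongrightarrow> 0"
      by (intro summable_LIMSEQ_zero sums_summable[OF finite_measure_UNION[of R]]) (use R in auto)
    then have "(\<lambda>i. measure M (Q i)) sums measure M A"
      unfolding sums_def sum using tendsto_diff[OF tendsto_const, of "\<lambda>n. measure M (R n)" 0 sequentially "measure M A"] by simp
    moreover have "disjoint_family Q"
    proof -
      have "Q m \<inter> Q n = {}" if "m < n" for m n
        using that AY by (auto simp: Q_def)
      then show ?thesis
        unfolding disjoint_family_on_def by (metis Int_commute linorder_neqE_nat)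
    qed
    then have "(\<lambda>i. measure M (Q i)) sums measure M (\<Union>i. Q i)"
      using Q by (intro finite_measure_UNION) auto
    moreover have "?T -` A \<inter> Y = (\<Union>i. Q i)"
    proof (intro set_eqI iffI)
      fix x assume x: "x \<in> ?T -` A \<inter> Y"
      let ?P = "\<lambda>n. 1 \<le> n \<and> (f ^^ n) x \<in> Y"
      define n where "n = (LEAST n. ?P n)"
      have "\<exists>n. ?P n" using return[of x] x by auto
      then have "?P n" unfolding n_def by (rule LeastI_ex)
      moreover have "\<not> ?P i" if "i < n" for i using that not_less_Least unfolding n_def by blast
      ultimately have P: "?P n" "\<And>i. i < n \<Longrightarrow> \<not> ?P i" by blast+
      obtain m where m: "n = Suc m" using P(1) by (cases n) auto
      have "(f ^^ n) x \<in> A" using x by (simp add: return_map_def n_def)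
      moreover have "(f ^^ Suc i) x \<notin> Y" if "i < m" for i using P(2)[of "Suc i"] m that by simp
      ultimately have "x \<in> Q m"
        using x unfolding m Q_def by blast
      then show "x \<in> (\<Union>i. Q i)" by blast
    next
      fix x assume "x \<in> (\<Union>i. Q i)"
      then obtain n where n: "x \<in> Y" "\<And>i. i < n \<Longrightarrow> (f ^^ Suc i) x \<notin> Y" "(f ^^ Suc n) x \<in> A"
        unfolding Q_def by blast
      have "(LEAST n. 1 \<le> n \<and> (f ^^ n) x \<in> Y) = Suc n"
      proof (rule Least_equality)
        show "1 \<le> Suc n \<and> (f ^^ Suc n) x \<in> Y" using n(3) AY by auto
        fix m assume m: "1 \<le> m \<and> (f ^^ m) x \<in> Y"
        then obtain i where i: "m = Suc i" by (cases m) auto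
        show "Suc n \<le> m"
          using n(2)[of i] m unfolding i by (meson Suc_le_mono not_less)
      qed
      then show "x \<in> ?T -` A \<inter> Y" using n unfolding return_map_def by simp
    qed
    ultimately show ?thesis using sums_unique2 by metis
  qed note key = this
  have "distr ?N ?N ?T = ?N"
  proof (rule measure_eqI)
    fix A assume "A \<in> sets (distr ?N ?N ?T)"
    then have A: "A \<in> sets ?N" by simp
    then have AY: "A \<in> sets M" "A \<subseteq> Y" using Y by (auto simp: sets_restrict_space)
    have "?T -` A \<inter> Y \<in> sets ?N" using measurable_sets[OF T A] spN by simp
    then have "?T -` A \<inter> Y \<in> sets M" using Y by (auto simp: sets_restrict_space)
    then show "emeasure (distr ?N ?N ?T) A = emeasure ?N A"
      using key[OF AY] AY by (simp add: emeasure_distr[OF T A] spN emeasure_restrict_space Y emeasure_eq_measure)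
  qed simp
  then show ?thesis using T by (simp add: measure_preserving_map_def)
qed

text \<open>
  The preimage under \<open>entry_map\<close> extends a set invariant under the return map to an
  \<open>f\<close>-invariant set with the same trace on \<open>Y\<close>.
\<close>

lemma return_map_ergodic:
  assumes "finite_measure M" and erg: "ergodic M f" and Y[measurable]: "Y \<in> sets M"
    and "Y \<noteq> {}" and return: "\<And>x. x \<in> Y \<Longrightarrow> \<exists>n\<ge>1. (f ^^ n) x \<in> Y"
  shows "ergodic (restrict_space M Y) (return_map f Y)"
  unfolding ergodic_def
proof (intro conjI ballI impI)
  let ?N = "restrict_space M Y" and ?T = "return_map f Y"
  have mp: "measure_preserving_map M f" and f: "f \<in> measurable M M"
    using erg by (auto simp: ergodic_def measure_preserving_map_def)
  show "measure_preserving_map ?N ?T"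
    by (rule return_map_measure_preserving) (use assms mp in auto)
  have YM: "Y \<subseteq> space M" using sets.sets_into_space[OF Y] .
  have spN: "space ?N = Y" using YM by (auto simp: space_restrict_space)
  fix A assume A: "A \<in> sets ?N" and inv: "?T -` A \<inter> space ?N = A"
  show "emeasure ?N A = 0 \<or> emeasure ?N (space ?N - A) = 0"
  proof -
    obtain c where c: "c \<in> Y" using \<open>Y \<noteq> {}\<close> by auto
    have AY: "A \<in> sets M" "A \<subseteq> Y" using A Y by (auto simp: sets_restrict_space)
    let ?P = "\<lambda>x. entry_map f Y c x \<in> A"
    have "?P (f x) \<longleftrightarrow> ?P x" if "x \<in> space M" for x
    proof (cases "x \<in> Y")
      case True
      have "return_map f Y x \<in> A \<longleftrightarrow> x \<in> A"
        using inv True spN by blast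
      then show ?thesis
        using True by (simp only: entry_map_step_inside[OF return[OF True]] entry_map_inside[OF True])
    qed (simp add: entry_map_step_outside)
    moreover have "{x \<in> space M. ?P x} \<in> sets M"
      using measurable_sets[OF measurable_entry_map[OF f Y c] A] by (simp add: vimage_def Int_def conj_commute)
    ultimately have "(AE x in M. ?P x) \<or> (AE x in M. \<not> ?P x)"
      by (intro ergodic_dichotomy[OF erg]) auto
    then have "(AE x in M. x \<notin> Y - A) \<or> (AE x in M. x \<notin> A)"
    proof
      assume "AE x in M. ?P x"
      then have "AE x in M. x \<notin> Y - A"
        by eventually_elim (auto simp: entry_map_inside)
      then show ?thesis ..
    next
      assume "AE x in M. \<not> ?P x"
      then have "AE x in M. x \<notin> A"
        by eventually_elim (use AY in \<open>auto simp: entry_map_inside\<close>)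
      then show ?thesis ..
    qed
    then have "Y - A \<in> null_sets M \<or> A \<in> null_sets M"
      using AE_iff_null_sets[OF sets.Diff[OF Y AY(1)]] AE_iff_null_sets[OF AY(1)] by blast
    then have "emeasure M (Y - A) = 0 \<or> emeasure M A = 0"
      by (auto dest: null_setsD1)
    then show ?thesis
      using AY by (auto simp: emeasure_restrict_space spN)
  qed
qed

lemma prob_space_uniform_measure_space:
  assumes "finite_measure M" "emeasure M (space M) \<noteq> 0"
  shows "prob_space (uniform_measure M (space M))"
  using assms finite_measure.emeasure_finite by (intro prob_space_uniform_measure) auto

lemma measure_preserving_map_uniform_measure:
  assumes mp: "measure_preserving_map M T"
  shows "measure_preserving_map (uniform_measure M (space M)) T"
  unfolding measure_preserving_map_def
proof
  let ?U = "uniform_measure M (space M)"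
  have T[measurable]: "T \<in> measurable M M" using mp by (simp add: measure_preserving_map_def)
  then show T': "T \<in> measurable ?U ?U" by simp
  show "distr ?U ?U T = ?U"
  proof (rule measure_eqI)
    fix A assume "A \<in> sets (distr ?U ?U T)"
    then have A: "A \<in> sets M" by simp
    have "T -` A \<inter> space M \<in> sets M" using A by measurable
    then show "emeasure (distr ?U ?U T) A = emeasure ?U A"
      using A measure_preserving_emeasure_vimage[OF mp A] sets.sets_into_space[OF A]
      by (simp add: emeasure_distr[OF T'] Int_absorb1 Int_absorb2)
  qed simp
qed

lemma ergodic_uniform_measure:
  assumes "ergodic M T"
  shows "ergodic (uniform_measure M (space M)) T"
  using assms measure_preserving_map_uniform_measure[of M T]
  unfolding ergodic_def by (auto simp: Int_absorb1 sets.sets_into_space)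

section \<open>Small translations of measurable families\<close>

lemma emeasure_lebesgue_translation:
  fixes S :: "real set"
  shows "emeasure lebesgue ((\<lambda>x. x + a) -` S) = emeasure lebesgue S"
proof -
  have "(\<lambda>x. x + a) -` S = (\<lambda>x. - a + x) ` S"
    by (auto simp: image_iff intro!: bexI[of _ "_ + a"])
  then show ?thesis
    using emeasure_lebesgue_affine[of 1 "- a" S] by (simp add: add.commute)
qed

lemma measurable_lebesgue_translation: "(\<lambda>x::real. x + a) \<in> measurable lebesgue lebesgue"
proof -
  have "(\<lambda>x. a + (\<Sum>j\<in>Basis. (1 * (x \<bullet> j)) *\<^sub>R j)) = (\<lambda>x::real. x + a)"
    by (simp add: fun_eq_iff)
  then show ?thesis
    using lebesgue_affine_measurable[of "\<lambda>_. 1::real" a] by simp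
qed

lemma measure_preserving_lebesgue_translation: "measure_preserving_map lebesgue (\<lambda>x::real. x + a)"
  unfolding measure_preserving_map_def
proof
  show T: "(\<lambda>x::real. x + a) \<in> measurable lebesgue lebesgue" by (rule measurable_lebesgue_translation)
  show "distr lebesgue lebesgue (\<lambda>x::real. x + a) = lebesgue"
    by (rule measure_eqI) (simp_all add: emeasure_distr[OF T] emeasure_lebesgue_translation)
qed

lemma space_leb_on [simp]: "space (leb_on b) = {0..<b}"
  by (simp add: leb_on_def space_restrict_space)

lemma sets_leb_on_iff: "A \<in> sets (leb_on b) \<longleftrightarrow> A \<in> sets lebesgue \<and> A \<subseteq> {0..<b}"
  by (auto simp: leb_on_def sets_restrict_space_iff)

lemma emeasure_leb_on: "A \<subseteq> {0..<b} \<Longrightarrow> emeasure (leb_on b) A = emeasure lebesgue A"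
  by (simp add: leb_on_def emeasure_restrict_space)

lemma finite_measure_leb_on: "finite_measure (leb_on b)"
  by (rule finite_measureI) (cases "0 \<le> b"; simp add: emeasure_leb_on)

text \<open>
  Squeeze \<open>B\<close> between a compact set \<open>K\<close> and an open set \<open>U\<close>. If \<open>r\<close> is less than the distance from \<open>K\<close> to the
  complement of \<open>U\<close>, a point that is separated from its translate by \<open>B\<close> lies, or has its translate,
  in \<open>U - K\<close>.
\<close>

lemma small_translation_difference:
  fixes B :: "real set" and e :: real
  assumes B: "B \<in> sets lebesgue" "bounded B" and e: "0 < e"
  obtains d where "0 < d" "\<And>r. \<lbrakk>0 \<le> r; r < d\<rbrakk> \<Longrightarrow>
     \<exists>C\<in>sets lebesgue. {y. (y \<in> B) \<noteq> (y + r \<in> B)} \<subseteq> C \<and> emeasure lebesgue C \<le> ennreal e"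
proof -
  have e4: "0 < e / 4" using e by simp
  obtain U where U: "open U" "B \<subseteq> U" "U - B \<in> lmeasurable" "emeasure lebesgue (U - B) < ennreal (e / 4)"
    using sets_lebesgue_outer_open[OF B(1) e4] .
  obtain K where K: "closed K" "K \<subseteq> B" "B - K \<in> lmeasurable" "emeasure lebesgue (B - K) < ennreal (e / 4)"
    using sets_lebesgue_inner_closed[OF B(1) e4] .
  have "compact K"
    using K B(2) bounded_subset by (auto simp: compact_eq_bounded_closed)
  moreover have "closed (- U)" "K \<inter> - U = {}" using U K by auto
  ultimately obtain d where d: "0 < d" "\<And>x y. x \<in> K \<Longrightarrow> y \<in> - U \<Longrightarrow> d \<le> dist x y"
    using separate_compact_closed[of K "- U"] by blast
  have UK: "U - K = (U - B) \<union> (B - K)" using U K by auto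
  have UK_sets: "U - K \<in> sets lebesgue" unfolding UK using U K by (intro sets.Un) auto
  have "emeasure lebesgue (U - K) \<le> emeasure lebesgue (U - B) + emeasure lebesgue (B - K)"
    unfolding UK using U K by (intro emeasure_subadditive) auto
  also have "\<dots> \<le> ennreal (e / 4) + ennreal (e / 4)"
    using U K by (intro add_mono) auto
  finally have UK_le: "emeasure lebesgue (U - K) \<le> ennreal (e / 2)"
    using e by (simp flip: ennreal_plus)
  show thesis
  proof
    show "0 < d" by fact
    fix r :: real assume r: "0 \<le> r" "r < d"
    let ?S = "(\<lambda>y. y + r) -` (U - K)"
    have S: "?S \<in> sets lebesgue"
      using measurable_sets[OF measurable_lebesgue_translation UK_sets, of r] by simp
    have "{y. (y \<in> B) \<noteq> (y + r \<in> B)} \<subseteq> (U - K) \<union> ?S"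
    proof
      fix y assume "y \<in> {y. (y \<in> B) \<noteq> (y + r \<in> B)}"
      then have "y \<in> B \<and> y + r \<notin> B \<or> y \<notin> B \<and> y + r \<in> B" by auto
      moreover have "y + r \<in> U" if "y \<in> K"
        using d(2)[OF that, of "y + r"] r by (auto simp: dist_real_def)
      moreover have "y \<in> U" if "y + r \<in> K"
        using d(2)[OF that, of y] r by (auto simp: dist_real_def)
      ultimately show "y \<in> (U - K) \<union> ?S"
        using U(2) K(2) by auto
    qed
    moreover have "emeasure lebesgue ((U - K) \<union> ?S) \<le> ennreal e"
    proof -
      have "emeasure lebesgue ((U - K) \<union> ?S) \<le> emeasure lebesgue (U - K) + emeasure lebesgue ?S"
        using UK_sets S by (rule emeasure_subadditive)
      also have "\<dots> \<le> ennreal (e / 2) + ennreal (e / 2)"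
        using UK_le by (intro add_mono) (simp_all only: emeasure_lebesgue_translation)
      finally show ?thesis using e by (simp flip: ennreal_plus)
    qed
    ultimately show "\<exists>C\<in>sets lebesgue. {y. (y \<in> B) \<noteq> (y + r \<in> B)} \<subseteq> C \<and> emeasure lebesgue C \<le> ennreal e"
      using UK_sets S by (intro bexI[of _ "(U - K) \<union> ?S"]) auto
  qed
qed

text \<open>
  A set \<open>F\<close> of pairs is read as a family of sets indexed by the second coordinate \<open>y \<in> [0,b)\<close>. The
  translation \<open>y \<mapsto> y + r\<close> leaves this interval, and both definitions keep only the \<open>y\<close> for which \<open>y + r\<close> is
  still an index.
\<close>

definition shift_preimage :: "real \<Rightarrow> real \<Rightarrow> ('a \<times> real) set \<Rightarrow> ('a \<times> real) set" where
  "shift_preimage b r F = {(x, y). 0 \<le> y \<and> y + r < b \<and> (x, y + r) \<in> F}"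

definition shift_diff :: "real \<Rightarrow> real \<Rightarrow> ('a \<times> real) set \<Rightarrow> ('a \<times> real) set" where
  "shift_diff b r F = {(x, y). 0 \<le> y \<and> y + r < b \<and> ((x, y) \<in> F \<longleftrightarrow> (x, y + r) \<notin> F)}"

locale shifted_product = finite_measure N for N :: "'a measure" +
  fixes b :: real
begin

abbreviation Q :: "('a \<times> real) measure" where "Q \<equiv> N \<Otimes>\<^sub>M leb_on b"

sublocale L: finite_measure "leb_on b" by (rule finite_measure_leb_on)

lemma finite_measure_Q: "finite_measure Q"
  by (intro finite_measure_pair_measure finite_measure_axioms L.finite_measure_axioms)

lemma sets_window: "{z \<in> space Q. snd z + r < b} \<in> sets Q"
proof -
  have "{y \<in> space (leb_on b). y + r < b} = {0..<b} \<inter> {..<b - r}" by auto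
  then have "{y \<in> space (leb_on b). y + r < b} \<in> sets (leb_on b)"
    by (simp add: sets_leb_on_iff)
  then have "Measurable.pred (leb_on b) (\<lambda>y. y + r < b)"
    by (simp only: pred_def)
  then have "Measurable.pred Q (\<lambda>z. snd z + r < b)"
    by (rule measurable_compose[OF measurable_snd])
  then show ?thesis by (simp only: pred_def)
qed

lemma sets_shift_preimage:
  assumes r: "0 \<le> r" and F: "F \<in> sets Q"
  shows "shift_preimage b r F \<in> sets Q"
proof -
  let ?\<psi> = "\<lambda>y. if y + r < b then y + r else y"
  have "?\<psi> \<in> measurable lebesgue lebesgue"
    by (intro measurable_If measurable_lebesgue_translation)
      (auto simp: pred_def space_lebesgue_on intro: measurable_ident_sets)
  then have \<psi>: "?\<psi> \<in> measurable (leb_on b) (leb_on b)"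
    unfolding leb_on_def
    by (intro measurable_restrict_space2 measurable_restrict_space1)
      (use r in \<open>auto simp: space_restrict_space\<close>)
  have \<phi>: "(\<lambda>z. (fst z, ?\<psi> (snd z))) \<in> measurable Q Q"
    by (intro measurable_Pair measurable_fst measurable_compose[OF measurable_snd \<psi>])
  have "shift_preimage b r F = ((\<lambda>z. (fst z, ?\<psi> (snd z))) -` F \<inter> space Q) \<inter> {z \<in> space Q. snd z + r < b}"
    using sets.sets_into_space[OF F] r
    by (auto simp: shift_preimage_def space_pair_measure split: if_splits)
  then show ?thesis
    by (simp only: sets.Int[OF measurable_sets[OF \<phi> F] sets_window])
qed

lemma measure_shift_preimage_le:
  assumes r: "0 \<le> r" and F: "F \<in> sets Q"
  shows "measure Q (shift_preimage b r F) \<le> measure Q F"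
proof -
  interpret Q: finite_measure Q by (rule finite_measure_Q)
  have "emeasure Q (shift_preimage b r F) \<le> emeasure Q F"
    unfolding L.emeasure_pair_measure_alt[OF F] L.emeasure_pair_measure_alt[OF sets_shift_preimage[OF r F]]
  proof (rule nn_integral_mono)
    fix x
    have sec: "Pair x -` F \<in> sets (leb_on b)" using F by (rule sets_Pair1)
    then have F': "Pair x -` F \<in> sets lebesgue" "Pair x -` F \<subseteq> {0..<b}" by (auto simp: sets_leb_on_iff)
    have "emeasure (leb_on b) (Pair x -` shift_preimage b r F) = emeasure lebesgue (Pair x -` shift_preimage b r F)"
      using r by (intro emeasure_leb_on) (auto simp: shift_preimage_def)
    also have "\<dots> \<le> emeasure lebesgue ((\<lambda>y. y + r) -` (Pair x -` F))"
      using measurable_sets[OF measurable_lebesgue_translation F'(1), of r]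
      by (intro emeasure_mono) (auto simp: shift_preimage_def)
    also have "\<dots> = emeasure (leb_on b) (Pair x -` F)"
      using F' by (simp only: emeasure_lebesgue_translation emeasure_leb_on)
    finally show "emeasure (leb_on b) (Pair x -` shift_preimage b r F) \<le> emeasure (leb_on b) (Pair x -` F)" .
  qed
  then show ?thesis by (simp add: Q.emeasure_eq_measure)
qed

lemma sets_shift_diff:
  assumes r: "0 \<le> r" and F: "F \<in> sets Q"
  shows "shift_diff b r F \<in> sets Q"
proof -
  have "shift_diff b r F = (F \<inter> {z \<in> space Q. snd z + r < b} - shift_preimage b r F) \<union> (shift_preimage b r F - F)"
  proof (rule set_eqI)
    fix z :: "'a \<times> real"
    obtain x y where z: "z = (x, y)" by fastforce
    have "(x, y) \<in> F \<Longrightarrow> (x, y) \<in> space Q \<and> 0 \<le> y"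
      using sets.sets_into_space[OF F] by (auto simp: space_pair_measure)
    then show "z \<in> shift_diff b r F \<longleftrightarrow>
        z \<in> (F \<inter> {z \<in> space Q. snd z + r < b} - shift_preimage b r F) \<union> (shift_preimage b r F - F)"
      unfolding z by (simp add: shift_diff_def shift_preimage_def) blast
  qed
  then show ?thesis
    by (simp only: sets.Un sets.Diff sets.Int sets_shift_preimage[OF r F] sets_window F)
qed

text \<open>
  Continuity of translation in measure, for families of sets. The property holds for rectangles by
  \<open>small_translation_difference\<close>; it passes to complements, which have the same \<open>shift_diff\<close>, and to
  disjoint unions, where a tail of small measure contributes at most twice that measure. These
  steps exhaust the product sigma algebra.
\<close>

lemma small_shift_diff:
  assumes "F \<in> sets Q"
  shows "\<forall>e>0. \<exists>d>0. \<forall>r. 0 \<le> r \<and> r < d \<longrightarrow> measure Q (shift_diff b r F) \<le> e"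
  using Int_stable_pair_measure_generator pair_measure_closed assms[unfolded sets_pair_measure]
proof (induction rule: sigma_sets_induct_disjoint)
  interpret Q: finite_measure Q by (rule finite_measure_Q)
  note shift = sets_shift_diff[unfolded sets_pair_measure]
  {
    case (basic F)
    then obtain A B where F: "F = A \<times> B" and A: "A \<in> sets N" and "B \<in> sets (leb_on b)" by auto
    then have B: "B \<in> sets lebesgue" "B \<subseteq> {0..<b}" by (auto simp: sets_leb_on_iff)
    show ?case
    proof (intro allI impI)
      fix e :: real assume e: "0 < e"
      define e' where "e' = e / (measure N A + 1)"
      have e': "0 < e'" using e by (simp add: e'_def add_nonneg_pos)
      have "bounded B" using B(2) bounded_subset by (rule_tac bounded_subset[of "{0..b}"]) auto
      then obtain d where d: "0 < d" "\<And>r. \<lbrakk>0 \<le> r; r < d\<rbrakk> \<Longrightarrow>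
          \<exists>C\<in>sets lebesgue. {y. (y \<in> B) \<noteq> (y + r \<in> B)} \<subseteq> C \<and> emeasure lebesgue C \<le> ennreal e'"
        using small_translation_difference[OF B(1) _ e'] by metis
      have "measure Q (shift_diff b r F) \<le> e" if r: "0 \<le> r" "r < d" for r
      proof -
        obtain C where C: "C \<in> sets lebesgue" "{y. (y \<in> B) \<noteq> (y + r \<in> B)} \<subseteq> C" "emeasure lebesgue C \<le> ennreal e'"
          using d(2)[OF r] by auto
        let ?C = "C \<inter> {0..<b}"
        have C': "?C \<in> sets (leb_on b)" using C by (auto simp: sets_leb_on_iff)
        have "shift_diff b r F \<subseteq> A \<times> ?C"
          using C(2) r by (auto simp: shift_diff_def F)
        then have "measure Q (shift_diff b r F) \<le> measure Q (A \<times> ?C)"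
          using A C' by (intro Q.finite_measure_mono) auto
        also have "\<dots> = measure N A * measure (leb_on b) ?C"
          using A C' by (simp add: measure_def L.emeasure_pair_measure_Times enn2real_mult)
        also have "measure (leb_on b) ?C \<le> e'"
        proof -
          have "emeasure (leb_on b) ?C = emeasure lebesgue ?C" by (rule emeasure_leb_on) auto
          also have "\<dots> \<le> emeasure lebesgue C" using C by (intro emeasure_mono) auto
          also note C(3)
          finally show ?thesis using e' by (simp add: L.emeasure_eq_measure)
        qed
        also have "measure N A * e' \<le> e"
        proof -
          have "0 < measure N A + 1" by (simp add: add_nonneg_pos)
          moreover have "e' * (measure N A + 1) = e"
            using \<open>0 < measure N A + 1\<close> by (simp add: e'_def)
          ultimately show ?thesis using e' by (simp add: algebra_simps)
        qed
        finally show ?thesis by (simp add: mult_left_mono)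
      qed
      then show "\<exists>d>0. \<forall>r. 0 \<le> r \<and> r < d \<longrightarrow> measure Q (shift_diff b r F) \<le> e" using d(1) by auto
    qed
  next
    case empty
    show ?case by (auto simp: shift_diff_def intro!: exI[of _ 1])
  next
    case (compl F)
    have "shift_diff b r (space N \<times> space (leb_on b) - F) = shift_diff b r F" if "0 \<le> r" for r
      using sets.sets_into_space[OF compl(1)[folded sets_pair_measure]] that
      by (auto simp: shift_diff_def space_pair_measure)
    then show ?case using compl(2) by (metis (no_types, lifting))
  next
    case (union A)
    have A: "A i \<in> sets Q" for i using union(2) unfolding sets_pair_measure by auto
    show ?case
    proof (intro allI impI)
      fix e :: real assume e: "0 < e"
      let ?U = "\<lambda>n. \<Union>i<n. A i" and ?A = "\<Union>i. A i"
      have U: "?U n \<in> sets Q" for n using A by auto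
      have AU: "?A \<in> sets Q" using A by auto
      have good: "\<forall>e>0. \<exists>d>0. \<forall>r. 0 \<le> r \<and> r < d \<longrightarrow> measure Q (shift_diff b r (?U n)) \<le> e" for n
      proof (induction n)
        case 0
        show ?case by (auto simp: shift_diff_def intro!: exI[of _ 1])
      next
        case (Suc n)
        show ?case
        proof (intro allI impI)
          fix e :: real assume "0 < e"
          then have e2: "0 < e / 2" by simp
          obtain d1 where d1: "0 < d1" "\<And>r. 0 \<le> r \<and> r < d1 \<Longrightarrow> measure Q (shift_diff b r (?U n)) \<le> e / 2"
            using Suc e2 by blast
          obtain d2 where d2: "0 < d2" "\<And>r. 0 \<le> r \<and> r < d2 \<Longrightarrow> measure Q (shift_diff b r (A n)) \<le> e / 2"
            using union(3) e2 by blast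
          have "measure Q (shift_diff b r (?U (Suc n))) \<le> e" if r: "0 \<le> r \<and> r < min d1 d2" for r
          proof -
            have "shift_diff b r (?U (Suc n)) \<subseteq> shift_diff b r (?U n) \<union> shift_diff b r (A n)"
              by (auto simp: shift_diff_def less_Suc_eq)
            then have "measure Q (shift_diff b r (?U (Suc n))) \<le> measure Q (shift_diff b r (?U n) \<union> shift_diff b r (A n))"
              using sets_shift_diff U A r by (intro Q.finite_measure_mono) auto
            also have "\<dots> \<le> measure Q (shift_diff b r (?U n)) + measure Q (shift_diff b r (A n))"
              using sets_shift_diff U A r by (intro measure_Un_le) auto
            finally show ?thesis using d1(2)[of r] d2(2)[of r] r by simp
          qed
          then show "\<exists>d>0. \<forall>r. 0 \<le> r \<and> r < d \<longrightarrow> measure Q (shift_diff b r (?U (Suc n))) \<le> e"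
            using d1(1) d2(1) by (intro exI[of _ "min d1 d2"]) auto
        qed
      qed
      have "(\<lambda>n. measure Q (?U n)) \<longlonglongrightarrow> measure Q (\<Union>n. ?U n)"
        using U by (intro Q.finite_Lim_measure_incseq) (auto simp: incseq_def intro: less_le_trans)
      moreover have "(\<Union>n. ?U n) = ?A" by auto
      ultimately have "\<forall>\<^sub>F n in sequentially. measure Q ?A - e / 4 < measure Q (?U n)"
        using e by (intro order_tendstoD) auto
      then obtain n where n: "measure Q ?A - e / 4 < measure Q (?U n)"
        by (auto simp: eventually_sequentially)
      let ?R = "?A - ?U n"
      have R: "?R \<in> sets Q" using AU U by blast
      have R_le: "measure Q ?R \<le> e / 4"
      proof -
        have "?U n \<subseteq> ?A" by auto
        then show ?thesis using n Q.finite_measure_Diff[OF AU U, of n] by simp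
      qed
      obtain d where d: "0 < d" "\<And>r. 0 \<le> r \<and> r < d \<Longrightarrow> measure Q (shift_diff b r (?U n)) \<le> e / 2"
        using good[of n] e by (metis half_gt_zero)
      have "measure Q (shift_diff b r ?A) \<le> e" if r: "0 \<le> r \<and> r < d" for r
      proof -
        have "shift_diff b r ?A \<subseteq> shift_diff b r (?U n) \<union> ?R \<union> shift_preimage b r ?R"
          by (auto simp: shift_diff_def shift_preimage_def)
        then have "measure Q (shift_diff b r ?A) \<le> measure Q (shift_diff b r (?U n) \<union> ?R \<union> shift_preimage b r ?R)"
          using sets_shift_diff[OF _ U] sets_shift_preimage[OF _ R] R r by (intro Q.finite_measure_mono) auto
        also have "\<dots> \<le> measure Q (shift_diff b r (?U n) \<union> ?R) + measure Q (shift_preimage b r ?R)"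
          using sets_shift_diff[OF _ U] sets_shift_preimage[OF _ R] R r by (intro measure_Un_le) auto
        also have "\<dots> \<le> measure Q (shift_diff b r (?U n)) + measure Q ?R + measure Q (shift_preimage b r ?R)"
          using sets_shift_diff[OF _ U] R r by (intro add_right_mono measure_Un_le) auto
        finally show ?thesis
          using d(2)[OF r] R_le measure_shift_preimage_le[OF _ R, of r] r by simp
      qed
      then show "\<exists>d>0. \<forall>r. 0 \<le> r \<and> r < d \<longrightarrow> measure Q (shift_diff b r ?A) \<le> e"
        using d(1) by auto
    qed
  }
qed

end

section \<open>Recurrence in interval exchanges\<close>

lemma iet_bij: "iet b f \<Longrightarrow> bij_betw f {0..<b} {0..<b}" by (simp add: iet_def)

text \<open>
  The left end point may be a discontinuity: right continuity is enough there.
\<close>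

lemma iet_translation:
  assumes iet: "iet b f" and uv: "0 \<le> u" "v \<le> b"
    and D: "discontinuities b f \<inter> {u<..<v} = {}" and y: "u \<le> y" "y < v"
  shows "f y = f u + (y - u)"
proof (cases "u = y")
  case False
  with y have "u < y" by simp
  have der: "DERIV f x :> 1" if x: "u < x" "x < v" for x
  proof -
    have "x \<in> {0..<b} - discontinuities b f" using x uv D by auto
    then have "(f has_real_derivative 1) (at x within {0..<b})"
      using iet unfolding iet_def by blast
    moreover have "x \<in> interior {0..<b}" using x uv by (auto simp: interior_atLeastLessThan)
    ultimately show ?thesis by (simp only: at_within_interior)
  qed
  have "\<forall>x\<in>{0..<b}. continuous (at_right x) f" using iet unfolding iet_def by blast
  moreover have "u \<in> {0..<b}" using uv y by simp
  ultimately have "continuous (at_right u) f" by blast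
  then have "continuous (at u within {u..y}) f"
    using \<open>u < y\<close> by (simp add: at_within_Icc_at_right)
  moreover have "continuous (at x within {u..y}) f" if "u < x" "x \<le> y" for x
    using continuous_at_imp_continuous_at_within[OF DERIV_isCont[OF der[of x]]] that y by simp
  ultimately have "continuous_on {u..y} f"
    by (auto simp: continuous_on_eq_continuous_within le_less)
  then have "continuous_on {u..y} (\<lambda>x. f x - x)" by (intro continuous_intros)
  moreover have "DERIV (\<lambda>x. f x - x) x :> 0" if "u < x" "x < y" for x
    using DERIV_diff[OF der DERIV_ident, of x] that y by simp
  ultimately have "f y - y = f u - u"
    by (intro DERIV_isconst_end \<open>u < y\<close>)
  then show ?thesis by simp
qed simp

lemma iet_funpow_mem: "iet b f \<Longrightarrow> x \<in> {0..<b} \<Longrightarrow> (f ^^ n) x \<in> {0..<b}"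
proof (induction n)
  case (Suc n)
  then show ?case using bij_betwE[OF iet_bij[of b f]] by simp
qed simp

lemma iet_funpow_eqD:
  assumes "iet b f" "x \<in> {0..<b}" "y \<in> {0..<b}" "(f ^^ n) x = (f ^^ (m + n)) y"
  shows "x = (f ^^ m) y"
proof -
  have "bij_betw (f ^^ n) {0..<b} {0..<b}"
    by (rule bij_betw_funpow[OF iet_bij[OF assms(1)]])
  then have "inj_on (f ^^ n) {0..<b}" by (rule bij_betw_imp_inj_on)
  moreover have "(f ^^ n) x = (f ^^ n) ((f ^^ m) y)"
    using assms(4) by (simp add: funpow_add add.commute[of m])
  ultimately show ?thesis
    using assms iet_funpow_mem by (meson inj_onD)
qed

text \<open>
  Poincare recurrence would give this for almost every \<open>y\<close> only. Suppose that \<open>y\<close> does not return.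
  An interval \<open>[y, y + s]\<close> that is translated by the iterates of \<open>f\<close> up to time \<open>n\<close> stops being so
  when a discontinuity \<open>d\<close> is met, \<open>f\<^sup>n (y + s) = d\<close>. The same \<open>d\<close> cannot stop two different
  lengths \<open>s' < s\<close>: that would give \<open>f\<^sup>m (y + s') = y + s\<close> for some \<open>m \<ge> 1\<close>, hence
  \<open>f\<^sup>m y = y + s - s' < t\<close>, a return. As there are finitely many discontinuities, some interval
  \<open>[y, y + \<epsilon>)\<close> is translated by all iterates. Two points of the orbit of \<open>y\<close> at distance below
  \<open>\<epsilon>\<close> would again produce a return, and the bounded interval \<open>[0,b)\<close> has no room for infinitely many points
  that are \<open>\<epsilon>\<close> apart.
\<close>

lemma iet_returns:
  assumes iet: "iet b f" and t: "t < b" and y: "y \<in> {0..<t}"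
  shows "\<exists>n\<ge>1. (f ^^ n) y \<in> {0..<t}"
proof (rule ccontr)
  assume no: "\<not> ?thesis"
  have yb: "y \<in> {0..<b}" using y t by auto
  have escape: "t \<le> (f ^^ m) y" if "1 \<le> m" for m
    using no that iet_funpow_mem[OF iet yb, of m] by force
  let ?D = "discontinuities b f"
  define translates where
    "translates n s \<longleftrightarrow> (\<forall>i\<le>n. \<forall>s'\<in>{0..s}. (f ^^ i) (y + s') = (f ^^ i) y + s')" for n s
  define S where "S d = {s. 0 < s \<and> y + s < t \<and> (\<exists>n. translates n s \<and> (f ^^ n) (y + s) = d)}" for d
  have S_unique: "s = s'" if "s \<in> S d" "s' \<in> S d" for s s' d
  proof -
    from that obtain n n' where n: "0 < s" "y + s < t" "translates n s" "(f ^^ n) (y + s) = d"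
      and n': "0 < s'" "y + s' < t" "translates n' s'" "(f ^^ n') (y + s') = d"
      by (auto simp: S_def)
    have orbit_cut: False
      if "n < n'" "0 < s" "y + s < t" "0 < s'" "y + s' < t" "translates n' s'"
        "(f ^^ n) (y + s) = (f ^^ n') (y + s')" for n n' s s'
    proof -
      let ?m = "n' - n"
      have "y + s \<in> {0..<b}" "y + s' \<in> {0..<b}" using that(2-5) y t by auto
      moreover have "(f ^^ n) (y + s) = (f ^^ (?m + n)) (y + s')" using that(1,7) by simp
      ultimately have "y + s = (f ^^ ?m) (y + s')" by (rule iet_funpow_eqD[OF iet])
      also have "\<dots> = (f ^^ ?m) y + s'"
        using \<open>translates n' s'\<close>[unfolded translates_def, rule_format, of ?m s'] \<open>0 < s'\<close> by simp
      finally have "(f ^^ ?m) y < t" using that(3,4) by simp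
      moreover have "1 \<le> ?m" using that(1) by simp
      ultimately show False using escape[of ?m] by linarith
    qed
    have eq: "(f ^^ n) (y + s) = (f ^^ n') (y + s')" using n(4) n'(4) by simp
    have "n = n'"
    proof (cases rule: linorder_cases[of n n'])
      case less
      then show ?thesis using orbit_cut[OF _ n(1,2) n'(1-3) eq] by blast
    next
      case greater
      then show ?thesis using orbit_cut[OF _ n'(1,2) n(1-3) eq[symmetric]] by blast
    qed
    then have "(f ^^ n) (y + s) = (f ^^ (0 + n)) (y + s')" using eq by (simp only: add_0)
    moreover have "y + s \<in> {0..<b}" "y + s' \<in> {0..<b}" using n(1,2) n'(1,2) y t by auto
    ultimately have "y + s = (f ^^ 0) (y + s')" by (rule_tac iet_funpow_eqD[OF iet])
    then show ?thesis by simp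
  qed
  define \<epsilon> where "\<epsilon> = Min (insert (t - y) (\<Union>d\<in>?D. S d))"
  have "finite (S d)" for d
  proof (cases "S d = {}")
    case False
    then obtain s where "s \<in> S d" by blast
    then have "S d \<subseteq> {s}" using S_unique by blast
    then show ?thesis by (rule finite_subset) simp
  qed simp
  then have fin: "finite (insert (t - y) (\<Union>d\<in>?D. S d))"
    using iet unfolding iet_def by blast
  have "\<epsilon> \<in> insert (t - y) (\<Union>d\<in>?D. S d)"
    unfolding \<epsilon>_def using fin by (rule Min_in) simp
  moreover have "0 < s" if "s \<in> S d" for d s using that by (simp add: S_def)
  ultimately have "0 < \<epsilon>" using y by auto
  moreover have \<epsilon>_le: "\<epsilon> \<le> s" if "s \<in> insert (t - y) (\<Union>d\<in>?D. S d)" for s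
    unfolding \<epsilon>_def using fin that by (rule Min_le)
  ultimately have \<epsilon>: "0 < \<epsilon>" "\<epsilon> \<le> t - y" "\<And>d s. d \<in> ?D \<Longrightarrow> s \<in> S d \<Longrightarrow> \<epsilon> \<le> s"
    by blast+
  have trans: "(f ^^ n) (y + s) = (f ^^ n) y + s" if "0 \<le> s" "s < \<epsilon>" for n s
    using that
  proof (induction n arbitrary: s rule: less_induct)
    case (less n)
    show ?case
    proof (cases n)
      case (Suc m)
      let ?u = "(f ^^ m) y"
      have IH: "(f ^^ i) (y + s') = (f ^^ i) y + s'" if "i \<le> m" "0 \<le> s'" "s' < \<epsilon>" for i s'
        using less.IH[of i s'] that Suc by simp
      have "?D \<inter> {?u<..<?u + \<epsilon>} = {}"
      proof (rule ccontr)
        assume "?D \<inter> {?u<..<?u + \<epsilon>} \<noteq> {}"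
        then obtain d where d: "d \<in> ?D" "?u < d" "d < ?u + \<epsilon>" by auto
        have "translates m (d - ?u)"
          unfolding translates_def using IH d by auto
        moreover have "(f ^^ m) (y + (d - ?u)) = d" using IH[of m "d - ?u"] d by simp
        ultimately have "d - ?u \<in> S d"
          unfolding S_def using d \<epsilon>(2) by auto
        then show False using \<epsilon>(3)[OF d(1)] d(3) by fastforce
      qed
      moreover have "?u \<in> {0..<b}" by (rule iet_funpow_mem[OF iet yb])
      \<comment> \<open>Otherwise the point \<open>b\<close>, which is outside the domain, would be a value of an iterate.\<close>
      moreover have "?u + \<epsilon> \<le> b"
      proof (rule ccontr)
        assume "\<not> ?u + \<epsilon> \<le> b"
        then have "(f ^^ m) (y + (b - ?u)) = b"
          using IH[of m "b - ?u"] \<open>?u \<in> {0..<b}\<close> by simp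
        moreover have "y + (b - ?u) \<in> {0..<b}"
          using \<open>\<not> ?u + \<epsilon> \<le> b\<close> \<open>?u \<in> {0..<b}\<close> \<epsilon>(2) y t by auto
        ultimately show False using iet_funpow_mem[OF iet, of "y + (b - ?u)" m] by auto
      qed
      ultimately have "f (?u + s) = f ?u + s"
        using iet_translation[OF iet, of ?u "?u + \<epsilon>" "?u + s"] less.prems by auto
      then show ?thesis using IH[of m s] less.prems Suc by simp
    qed simp
  qed
  have sep: False if "m < n" "\<bar>(f ^^ n) y - (f ^^ m) y\<bar> < \<epsilon>" for m n
  proof -
    define s where "s = \<bar>(f ^^ n) y - (f ^^ m) y\<bar>"
    have s: "0 \<le> s" "s < \<epsilon>" "y + s \<in> {0..<b}" using that \<epsilon>(2) y t by (auto simp: s_def)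
    have pos: "1 \<le> n - m" using that(1) by simp
    consider "(f ^^ n) y = (f ^^ m) y + s" | "(f ^^ m) y = (f ^^ n) y + s"
      unfolding s_def by linarith
    then show False
    proof cases
      case 1
      then have "(f ^^ m) (y + s) = (f ^^ ((n - m) + m)) y"
        using trans[OF s(1,2), of m] that by simp
      then have "y + s = (f ^^ (n - m)) y"
        by (rule iet_funpow_eqD[OF iet s(3) yb])
      then show False using escape[OF pos] s \<epsilon>(2) by linarith
    next
      case 2
      then have "(f ^^ m) y = (f ^^ ((n - m) + m)) (y + s)"
        using trans[OF s(1,2), of n] that by simp
      then have "y = (f ^^ (n - m)) (y + s)"
        by (rule iet_funpow_eqD[OF iet yb s(3)])
      then have "y = (f ^^ (n - m)) y + s" using trans[OF s(1,2)] by simp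
      then show False using escape[OF pos] s y by auto
    qed
  qed
  \<comment> \<open>Cells of length \<open>\<epsilon>\<close>: orbit points that are \<open>\<epsilon>\<close> apart occupy different ones.\<close>
  let ?g = "\<lambda>n. \<lfloor>(f ^^ n) y / \<epsilon>\<rfloor>"
  have "inj ?g"
  proof (rule linorder_injI)
    fix m n :: nat assume "m < n"
    show "?g m \<noteq> ?g n"
    proof
      assume "?g m = ?g n"
      then have "\<bar>(f ^^ n) y / \<epsilon> - (f ^^ m) y / \<epsilon>\<bar> < 1" by linarith
      then have "\<bar>(f ^^ n) y - (f ^^ m) y\<bar> < \<epsilon>"
        using \<epsilon>(1) by (simp add: abs_if field_simps split: if_splits)
      then show False using sep[OF \<open>m < n\<close>] by simp
    qed
  qed
  moreover have "range ?g \<subseteq> {0..\<lfloor>b / \<epsilon>\<rfloor>}"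
  proof
    fix k assume "k \<in> range ?g"
    then obtain n where k: "k = ?g n" by auto
    have "0 \<le> (f ^^ n) y / \<epsilon>" "(f ^^ n) y / \<epsilon> \<le> b / \<epsilon>"
      using iet_funpow_mem[OF iet yb, of n] \<epsilon>(1) by (auto intro: divide_right_mono)
    then show "k \<in> {0..\<lfloor>b / \<epsilon>\<rfloor>}" unfolding k by (auto intro: floor_mono)
  qed
  ultimately show False
    using finite_subset[of "range ?g" "{0..\<lfloor>b / \<epsilon>\<rfloor>}"] finite_imageD[of ?g UNIV] by auto
qed

section \<open>Towers of translated intervals\<close>

text \<open>
  The levels are the intervals of radius \<open>r\<close> about \<open>p k\<close>, \<open>\<bar>k\<bar> \<le> n\<close>; the last clause makes them
  disjoint.
\<close>

definition translation_tower :: "real \<Rightarrow> (real \<Rightarrow> real) \<Rightarrow> nat \<Rightarrow> real \<Rightarrow> (int \<Rightarrow> real) \<Rightarrow> bool" where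
  "translation_tower b f n r p \<longleftrightarrow>
     (\<forall>k\<in>{-int n..int n}. \<forall>s. \<bar>s\<bar> < r \<longrightarrow> p k + s \<in> {0..<b}) \<and>
     (\<forall>k\<in>{-int n..<int n}. \<forall>s. \<bar>s\<bar> < r \<longrightarrow> f (p k + s) = p (k + 1) + s) \<and>
     (\<forall>j\<in>{-int n..int n}. \<forall>k\<in>{-int n..int n}. j \<noteq> k \<longrightarrow> 2 * r \<le> \<bar>p j - p k\<bar>)"

lemma translation_towerD:
  assumes "translation_tower b f n r p"
  shows "k \<in> {-int n..int n} \<Longrightarrow> \<bar>s\<bar> < r \<Longrightarrow> p k + s \<in> {0..<b}"
    and "k \<in> {-int n..<int n} \<Longrightarrow> \<bar>s\<bar> < r \<Longrightarrow> f (p k + s) = p (k + 1) + s"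
    and "j \<in> {-int n..int n} \<Longrightarrow> k \<in> {-int n..int n} \<Longrightarrow> j \<noteq> k \<Longrightarrow> 2 * r \<le> \<bar>p j - p k\<bar>"
  using assms unfolding translation_tower_def by simp_all

lemma int_iterate_mem:
  assumes "iet b f" "x \<in> {0..<b}"
  shows "int_iterate b f k x \<in> {0..<b}"
proof -
  have "(inv_into {0..<b} f ^^ n) x \<in> {0..<b}" for n
    by (induction n) (use assms bij_betw_inv_into[OF iet_bij[OF assms(1)]] in \<open>auto dest!: bij_betwE\<close>)
  then show ?thesis
    using iet_funpow_mem[OF assms] by (auto simp: int_iterate_def)
qed

lemma int_iterate_step:
  assumes iet: "iet b f" and x: "x \<in> {0..<b}"
  shows "f (int_iterate b f k x) = int_iterate b f (k + 1) x"
proof (cases "0 \<le> k")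
  case True
  then show ?thesis by (simp add: int_iterate_def nat_add_distrib)
next
  case False
  define n where "n = nat (- (k + 1))"
  have k: "nat (- k) = Suc n" using False by (simp add: n_def)
  have "f (int_iterate b f k x) = f (inv_into {0..<b} f ((inv_into {0..<b} f ^^ n) x))"
    using False by (simp add: int_iterate_def k)
  also have "\<dots> = (inv_into {0..<b} f ^^ n) x"
  proof (rule f_inv_into_f)
    have "(inv_into {0..<b} f ^^ n) x = int_iterate b f (- int n) x"
      by (cases "n = 0") (auto simp: int_iterate_def)
    then show "(inv_into {0..<b} f ^^ n) x \<in> f ` {0..<b}"
      using int_iterate_mem[OF assms] bij_betw_imp_surj_on[OF iet_bij[OF iet]] by metis
  qed
  also have "\<dots> = int_iterate b f (k + 1) x"
    using False by (cases "k = -1") (auto simp: int_iterate_def n_def)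
  finally show ?thesis .
qed

lemma rho'_n_tower:
  assumes iet: "iet b f" and t: "t \<in> {0..<b}" and n: "1 \<le> n" and r: "0 < rho'_n b f n t"
  shows "translation_tower b f n (rho'_n b f n t) (\<lambda>k. int_iterate b f k t)"
proof -
  let ?r = "rho'_n b f n t" and ?p = "\<lambda>k. int_iterate b f k t" and ?D = "discontinuities b f"
  have fin: "finite ?D" using iet by (simp add: iet_def)
  have dist: "?r \<le> \<bar>?p k - d\<bar>" if "k \<in> {-int n..<int n}" "d \<in> ?D \<union> {0, b}" for k d
  proof -
    have "?r \<le> rho_n b f n t" by (simp add: rho'_n_def)
    also have "\<dots> \<le> rho b f (?p k)"
      unfolding rho_n_def using that by (intro Min_le) auto
    also have "\<dots> \<le> \<bar>?p k - d\<bar>"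
      unfolding rho_def using that fin by (intro Min_le) auto
    finally show ?thesis .
  qed
  have low: "?p k + s \<in> {0..<b} \<and> f (?p k + s) = ?p (k + 1) + s" if k: "k \<in> {-int n..<int n}" and s: "\<bar>s\<bar> < ?r" for k s
  proof -
    have "?p k \<in> {0..<b}" by (rule int_iterate_mem[OF iet t])
    then have bounds: "?r \<le> ?p k" "?p k + ?r \<le> b"
      using dist[OF k, of 0] dist[OF k, of b] by auto
    have "?D \<inter> {?p k - ?r<..<?p k + ?r} = {}"
      using dist[OF k] by force
    then have "f y = f (?p k - ?r) + (y - (?p k - ?r))" if "?p k - ?r \<le> y" "y < ?p k + ?r" for y
      using iet_translation[OF iet, of "?p k - ?r" "?p k + ?r" y] bounds that by auto
    from this[of "?p k + s"] this[of "?p k"] have "f (?p k + s) = f (?p k) + s"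
      using s r by auto
    then show ?thesis using bounds s int_iterate_step[OF iet t, of k] by auto
  qed
  have sep: "2 * ?r \<le> \<bar>?p j - ?p k\<bar>" if "j \<in> {-int n..int n}" "k \<in> {-int n..int n}" "j \<noteq> k" for j k
  proof -
    let ?A = "{\<bar>?p j - ?p k\<bar> | j k. \<bar>j\<bar> \<le> int n \<and> \<bar>k\<bar> \<le> int n \<and> j \<noteq> k}"
    have "?A \<subseteq> (\<lambda>(j, k). \<bar>?p j - ?p k\<bar>) ` ({-int n..int n} \<times> {-int n..int n})" by force
    then have "finite ?A" by (rule finite_subset) auto
    moreover have "\<bar>j\<bar> \<le> int n" "\<bar>k\<bar> \<le> int n" using that by auto
    then have "\<bar>?p j - ?p k\<bar> \<in> ?A" using that(3) by blast
    ultimately have "Delta_n b f n t \<le> \<bar>?p j - ?p k\<bar>"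
      unfolding Delta_n_def by (rule Min_le)
    then show ?thesis by (simp add: rho'_n_def)
  qed
  \<comment> \<open>\<open>rho_n\<close> says nothing about the top level, which is the image of the one below it.\<close>
  have top: "?p (int n) + s \<in> {0..<b}" if "\<bar>s\<bar> < ?r" for s
  proof -
    have "?p (int n) + s = f (?p (int n - 1) + s)" using low[of "int n - 1" s] n that by auto
    also have "\<dots> \<in> {0..<b}"
      using low[of "int n - 1" s] n that bij_betwE[OF iet_bij[OF iet]]
      by (intro bspec[of _ "\<lambda>a. f a \<in> {0..<b}"]) auto
    finally show ?thesis .
  qed
  have "?p k + s \<in> {0..<b}" if "k \<in> {-int n..int n}" "\<bar>s\<bar> < ?r" for k s
    using low[of k s] top[of s] that by (cases "k = int n") auto
  then show ?thesis
    unfolding translation_tower_def using low sep by auto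
qed

lemma psi_pos_frequently:
  assumes "0 < psi b f t"
  obtains c :: real where "0 < c" "\<exists>\<^sub>F n in sequentially. c < real n * rho'_n b f n t"
proof -
  obtain c where c: "0 < ereal c" "ereal c < psi b f t"
    using ereal_dense2[OF assms] by auto
  have "\<exists>\<^sub>F n in sequentially. c < real n * rho'_n b f n t"
  proof (rule ccontr)
    assume "\<not> ?thesis"
    then have "\<forall>\<^sub>F n in sequentially. ereal (real n * rho'_n b f n t) \<le> ereal c"
      by (simp add: frequently_def not_less)
    then have "psi b f t \<le> ereal c"
      unfolding psi_def by (rule Limsup_bounded)
    then show False using c by simp
  qed
  then show thesis using c that by simp
qed

text \<open>
  The intervals \<open>(p k - r, p k)\<close> are disjoint, so the integral of \<open>h\<close> is at least the sum of its
  integrals over them, and translating each of them to \<open>(-r, 0)\<close> turns this sum into the integral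
  of one function bounded below by \<open>C\<close>.
\<close>

lemma separated_translates_integral:
  fixes h :: "real \<Rightarrow> ennreal" and C r :: real
  assumes h: "h \<in> borel_measurable (leb_on b)" and r: "0 < r" and "finite K"
    and mem: "\<And>k s. k \<in> K \<Longrightarrow> -r < s \<Longrightarrow> s < 0 \<Longrightarrow> p k + s \<in> {0..<b}"
    and sep: "\<And>j k. j \<in> K \<Longrightarrow> k \<in> K \<Longrightarrow> j \<noteq> k \<Longrightarrow> r \<le> \<bar>p j - p k\<bar>"
    and C: "0 \<le> C" "AE s in lebesgue. -r < s \<and> s < 0 \<longrightarrow> ennreal C \<le> (\<Sum>k\<in>K. h (p k + s))"
  shows "ennreal (C * r) \<le> (\<integral>\<^sup>+y. h y \<partial>leb_on b)"
proof -
  define H where "H y = h y * indicator {0..<b} y" for y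
  have H[measurable]: "H \<in> borel_measurable lebesgue"
    using h unfolding H_def leb_on_def by (subst (asm) borel_measurable_restrict_space_iff_ennreal) auto
  let ?J = "\<lambda>k. indicator {p k - r<..<p k} :: real \<Rightarrow> ennreal"
  have H_trans[measurable]: "(\<lambda>s. H (p k + s)) \<in> borel_measurable lebesgue" for k
    using measurable_compose[OF measurable_lebesgue_translation[of "p k"] H] by (simp add: add.commute)
  have "ennreal (C * r) = (\<integral>\<^sup>+s. ennreal C * indicator {-r<..<0} s \<partial>lebesgue)"
    using C(1) r by (simp add: nn_integral_cmult_indicator ennreal_mult')
  also have "\<dots> \<le> (\<integral>\<^sup>+s. (\<Sum>k\<in>K. H (p k + s) * indicator {-r<..<0} s) \<partial>lebesgue)"
  proof (rule nn_integral_mono_AE)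
    show "AE s in lebesgue. ennreal C * indicator {-r<..<0} s \<le> (\<Sum>k\<in>K. H (p k + s) * indicator {-r<..<0} s)"
      using C(2)
    proof eventually_elim
      case (elim s)
      have "(\<Sum>k\<in>K. H (p k + s)) = (\<Sum>k\<in>K. h (p k + s))" if "-r < s" "s < 0"
        using mem[OF _ that] by (intro sum.cong) (auto simp: H_def)
      then show ?case using elim by (auto simp: indicator_def)
    qed
  qed
  also have "\<dots> = (\<Sum>k\<in>K. \<integral>\<^sup>+s. H (p k + s) * indicator {-r<..<0} s \<partial>lebesgue)"
    by (intro nn_integral_sum borel_measurable_times_ennreal H_trans borel_measurable_indicator) auto
  also have "\<dots> = (\<Sum>k\<in>K. \<integral>\<^sup>+y. H y * ?J k y \<partial>lebesgue)"
  proof (rule sum.cong[OF refl])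
    fix k
    have "(\<integral>\<^sup>+y. H y * ?J k y \<partial>lebesgue) = (\<integral>\<^sup>+s. H (p k + 1 * s) * ?J k (p k + 1 * s) \<partial>lebesgue)"
      by (subst nn_integral_real_affine_lebesgue[of _ 1 "p k"])
        (auto intro!: borel_measurable_times_ennreal H borel_measurable_indicator)
    also have "\<dots> = (\<integral>\<^sup>+s. H (p k + s) * indicator {-r<..<0} s \<partial>lebesgue)"
      by (intro nn_integral_cong) (auto simp: indicator_def)
    finally show "(\<integral>\<^sup>+s. H (p k + s) * indicator {-r<..<0} s \<partial>lebesgue) = (\<integral>\<^sup>+y. H y * ?J k y \<partial>lebesgue)" ..
  qed
  also have "\<dots> = (\<integral>\<^sup>+y. (\<Sum>k\<in>K. H y * ?J k y) \<partial>lebesgue)"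
    by (intro nn_integral_sum[symmetric] borel_measurable_times_ennreal H borel_measurable_indicator) auto
  also have "\<dots> \<le> (\<integral>\<^sup>+y. H y \<partial>lebesgue)"
  proof (rule nn_integral_mono)
    fix y
    have "disjoint_family_on (\<lambda>k. {p k - r<..<p k}) K"
      using sep by (force simp: disjoint_family_on_def)
    then have "(\<Sum>k\<in>K. ?J k y) = indicator (\<Union>k\<in>K. {p k - r<..<p k}) y"
      by (rule indicator_UN_disjoint[OF \<open>finite K\<close>, symmetric])
    also have "\<dots> \<le> 1" by (simp add: indicator_def)
    finally have "H y * (\<Sum>k\<in>K. ?J k y) \<le> H y * 1" by (rule mult_left_mono) simp
    then show "(\<Sum>k\<in>K. H y * ?J k y) \<le> H y" by (simp add: sum_distrib_left)
  qed
  also have "\<dots> = (\<integral>\<^sup>+y. h y \<partial>leb_on b)"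
    unfolding H_def leb_on_def by (rule nn_integral_restrict_space[symmetric]) simp
  finally show ?thesis .
qed

section \<open>The family of sections of an invariant set\<close>

definition meas_dist :: "'a measure \<Rightarrow> 'a set \<Rightarrow> 'a set \<Rightarrow> real" where
  "meas_dist M A B = measure M ((A - B) \<union> (B - A))"

lemma (in finite_measure) meas_dist_triangle:
  assumes "A \<in> sets M" "B \<in> sets M" "C \<in> sets M"
  shows "meas_dist M A C \<le> meas_dist M A B + meas_dist M B C"
proof -
  have "meas_dist M A C \<le> measure M (((A - B) \<union> (B - A)) \<union> ((B - C) \<union> (C - B)))"
    unfolding meas_dist_def using assms by (intro finite_measure_mono) auto
  also have "\<dots> \<le> meas_dist M A B + meas_dist M B C"
    unfolding meas_dist_def using assms by (intro measure_Un_le) auto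
  finally show ?thesis .
qed

lemma meas_dist_commute: "meas_dist M A B = meas_dist M B A"
  by (simp add: meas_dist_def Un_commute)

lemma meas_dist_vimage:
  assumes mp: "measure_preserving_map M T" and "A \<in> sets M" "B \<in> sets M"
  shows "meas_dist M (T -` A \<inter> space M) (T -` B \<inter> space M) = meas_dist M A B"
proof -
  have "(T -` A \<inter> space M - T -` B \<inter> space M) \<union> (T -` B \<inter> space M - T -` A \<inter> space M)
      = T -` ((A - B) \<union> (B - A)) \<inter> space M" by auto
  then show ?thesis
    using measure_preserving_emeasure_vimage[OF mp, of "(A - B) \<union> (B - A)"] assms
    by (simp add: meas_dist_def measure_def)
qed

lemma chain_int_eq:
  fixes g :: "int \<Rightarrow> 'a"
  assumes "\<And>k. a \<le> k \<Longrightarrow> k < c \<Longrightarrow> g (k + 1) = g k" "a \<le> j" "j \<le> c"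
  shows "g j = g a"
  using assms(2,3)
proof (induction j rule: int_ge_induct)
  case (step i)
  then show ?case using assms(1)[of i] by simp
qed simp

text \<open>
  The map \<open>e\<close> is the first entry to \<open>[0,t)\<close>, represented by its three equations; through them
  \<open>T\<close> is tied to \<open>f\<close>.
\<close>

locale skew_sections = N: prob_space N for N :: "real measure" +
  fixes b t :: real and f T e :: "real \<Rightarrow> real" and E :: "(real \<times> real) set"
  assumes t: "0 < t" "t < b"
    and space_N: "space N = {0..<t}"
    and T: "measure_preserving_map N T"
    and f: "ergodic (leb_on b) f"
    and e: "e \<in> measurable (leb_on b) N"
    and e_out: "\<And>y. y \<in> {0..<b} \<Longrightarrow> y \<notin> {0..<t} \<Longrightarrow> e (f y) = e y"
    and e_in: "\<And>y. y \<in> {0..<t} \<Longrightarrow> e (f y) = T y"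
    and e_id: "\<And>y. y \<in> {0..<t} \<Longrightarrow> e y = y"
    and E: "E \<in> sets (N \<Otimes>\<^sub>M N)"
    and E_inv: "\<And>x y. x \<in> {0..<t} \<Longrightarrow> y \<in> {0..<t} \<Longrightarrow> (T x, T y) \<in> E \<longleftrightarrow> (x, y) \<in> E"
begin

sublocale shifted_product N b ..

definition sec :: "real \<Rightarrow> real set" where
  "sec y = {x \<in> {0..<t}. (x, e y) \<in> E}"

abbreviation pull :: "real set \<Rightarrow> real set" where
  "pull A \<equiv> T -` A \<inter> space N"

text \<open>
  The extended family of sections as a subset of the product, for use with \<open>shift_diff\<close>.
\<close>

definition family :: "(real \<times> real) set" where
  "family = {(x, y). y \<in> {0..<b} \<and> x \<in> sec y}"

lemma measurable_T [measurable]: "T \<in> measurable N N"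
  using T unfolding measure_preserving_map_def by blast

lemma T_mem: "x \<in> {0..<t} \<Longrightarrow> T x \<in> {0..<t}"
  using measurable_space[OF measurable_T] by (simp add: space_N)

lemma f_mem: "y \<in> {0..<b} \<Longrightarrow> f y \<in> {0..<b}"
  using f measurable_space[of f "leb_on b" "leb_on b" y]
  unfolding ergodic_def measure_preserving_map_def space_leb_on by blast

lemma sets_family: "family \<in> sets Q"
proof -
  have "(\<lambda>z. (fst z, e (snd z))) \<in> measurable Q (N \<Otimes>\<^sub>M N)"
    using e by (intro measurable_Pair measurable_fst measurable_compose[OF measurable_snd])
  moreover have "family = (\<lambda>z. (fst z, e (snd z))) -` E \<inter> space Q"
    by (auto simp: family_def sec_def space_pair_measure space_N)
  ultimately show ?thesis using measurable_sets[OF _ E] by metis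
qed

lemma sets_sec: "y \<in> {0..<b} \<Longrightarrow> sec y \<in> sets N"
proof -
  assume "y \<in> {0..<b}"
  then have "(\<lambda>x. (x, y)) -` family = sec y"
    by (auto simp: family_def)
  then show ?thesis using sets_Pair2[OF sets_family, of y] by simp
qed

lemma sets_pull: "A \<in> sets N \<Longrightarrow> pull A \<in> sets N"
  by (rule measurable_sets[OF measurable_T])

lemma sec_step_outside: "y \<in> {0..<b} \<Longrightarrow> y \<notin> {0..<t} \<Longrightarrow> sec (f y) = sec y"
  by (simp add: sec_def e_out)

lemma sec_step_inside: "y \<in> {0..<t} \<Longrightarrow> pull (sec (f y)) = sec y"
proof (rule set_eqI)
  fix x assume "y \<in> {0..<t}"
  then show "x \<in> pull (sec (f y)) \<longleftrightarrow> x \<in> sec y"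
    using T_mem[of x] E_inv[of x y] e_in[of y] e_id[of y] unfolding sec_def space_N by auto
qed

text \<open>
  Both sections are moved by \<open>T\<close>, or neither of them is. Two points on different sides of \<open>t\<close> are the only case in
  which the distance can change.
\<close>

lemma dist_step:
  assumes "y \<in> {0..<b}" "y' \<in> {0..<b}" "y < t \<longleftrightarrow> y' < t"
  shows "meas_dist N (sec (f y)) (sec (f y')) = meas_dist N (sec y) (sec y')"
proof (cases "y < t")
  case True
  then have "pull (sec (f y)) = sec y" "pull (sec (f y')) = sec y'"
    using assms by (auto intro!: sec_step_inside)
  then show ?thesis
    using meas_dist_vimage[OF T sets_sec[OF f_mem[OF assms(1)]] sets_sec[OF f_mem[OF assms(2)]]] by simp
next
  case False
  then show ?thesis using assms by (simp add: sec_step_outside)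
qed

text \<open>
  The failure of the section to be \<open>T\<close>-invariant, the counterpart of \<open>\<bar>\<omega> - 1\<bar>\<close> for an eigenvalue \<open>\<omega>\<close>.
\<close>

definition defect :: "real \<Rightarrow> real" where
  "defect y = meas_dist N (sec y) (pull (sec y))"

lemma defect_invariant:
  assumes y: "y \<in> {0..<b}"
  shows "defect (f y) = defect y"
proof (cases "y < t")
  case True
  then have "pull (sec (f y)) = sec y" using y by (intro sec_step_inside) auto
  then show ?thesis
    using meas_dist_vimage[OF T sets_sec[OF f_mem[OF y]] sets_pull[OF sets_sec[OF f_mem[OF y]]]]
    by (simp add: defect_def)
next
  case False
  then show ?thesis using y by (simp add: defect_def sec_step_outside)
qed

lemma measurable_defect: "defect \<in> borel_measurable (leb_on b)"
proof -
  interpret NL: pair_sigma_finite N "leb_on b" ..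
  have "(\<lambda>z. (T (fst z), snd z)) \<in> measurable Q Q"
    by (intro measurable_Pair measurable_snd measurable_compose[OF measurable_fst measurable_T])
  then have G: "(\<lambda>z. (T (fst z), snd z)) -` family \<inter> space Q \<in> sets Q" (is "?G \<in> _")
    by (rule measurable_sets[OF _ sets_family])
  have "(family - ?G) \<union> (?G - family) \<in> sets Q"
    using G sets_family by blast
  then have "(\<lambda>y. emeasure N ((\<lambda>x. (x, y)) -` ((family - ?G) \<union> (?G - family)))) \<in> borel_measurable (leb_on b)"
    by (rule NL.measurable_emeasure_Pair2)
  then have "(\<lambda>y. enn2real (emeasure N ((\<lambda>x. (x, y)) -` ((family - ?G) \<union> (?G - family))))) \<in> borel_measurable (leb_on b)"
    by measurable
  then show ?thesis
  proof (rule measurable_cong[THEN iffD1, rotated])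
    fix y assume "y \<in> space (leb_on b)"
    then have "(\<lambda>x. (x, y)) -` ((family - ?G) \<union> (?G - family)) = (sec y - pull (sec y)) \<union> (pull (sec y) - sec y)"
      by (auto simp: family_def space_pair_measure space_N sec_def)
    then show "enn2real (emeasure N ((\<lambda>x. (x, y)) -` ((family - ?G) \<union> (?G - family)))) = defect y"
      by (simp add: defect_def meas_dist_def measure_def)
  qed
qed

text \<open>
  Here \<open>t + s < t < t + s + r\<close> are two points of the base on different sides of \<open>t\<close>. Going down from
  the base the distance of their sections does not change. In the step up to level \<open>1\<close> only the
  section of the left point is moved by \<open>T\<close>, so that the distance there equals that of \<open>sec (t + s)\<close> and
  \<open>pull (sec (t + s + r))\<close>; above it does not change any more. The triangle inequality bounds the
  defect by the sum of the two distances, each of which occurs on at least \<open>n\<close> levels.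
\<close>

lemma defect_le_tower_sum:
  assumes tower: "translation_tower b f n r p" and p0: "p 0 = t" and n: "1 \<le> n" and s: "-r < s" "s < 0"
  shows "real n * defect (t + s + r)
    \<le> (\<Sum>k\<in>{-int n..int n}. meas_dist N (sec (p k + s)) (sec (p k + s + r)))"
proof -
  let ?d = "\<lambda>k. meas_dist N (sec (p k + s)) (sec (p k + s + r))"
  have mem: "p k + s \<in> {0..<b}" "p k + s + r \<in> {0..<b}" if "k \<in> {-int n..int n}" for k
    using translation_towerD(1)[OF tower that, of s] translation_towerD(1)[OF tower that, of "s + r"] s
    by (auto simp: add.assoc)
  have step: "f (p k + s) = p (k + 1) + s" "f (p k + s + r) = p (k + 1) + s + r" if "k \<in> {-int n..<int n}" for k
    using translation_towerD(2)[OF tower that, of s] translation_towerD(2)[OF tower that, of "s + r"] s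
    by (auto simp: add.assoc)
  \<comment> \<open>A level other than the base keeps the distance \<open>2 r - r = r\<close> from \<open>t\<close>, hence lies on one side of it.\<close>
  have side: "p k + s < t \<longleftrightarrow> p k + s + r < t" if "k \<in> {-int n..int n}" "k \<noteq> 0" for k
  proof -
    have "2 * r \<le> \<bar>p k - p 0\<bar>" using translation_towerD(3)[OF tower that(1), of 0] that(2) by simp
    then show ?thesis using p0 s by auto
  qed
  have chain: "?d (k + 1) = ?d k" if "k \<in> {-int n..<int n}" "k \<noteq> 0" for k
    using dist_step[OF mem(1)[of k] mem(2)[of k] side[of k]] step[of k] that by auto
  have low: "?d k = ?d 0" if "k \<in> {-int n..0}" for k
  proof -
    have "?d j = ?d (- int n)" if "j \<in> {-int n..0}" for j
      using that by (intro chain_int_eq[of "- int n" 0 ?d]) (auto intro!: chain)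
    from this[of k] this[of 0] show ?thesis using that n by simp
  qed
  have up: "?d k = ?d 1" if "k \<in> {1..int n}" for k
    using that by (intro chain_int_eq[of 1 "int n" ?d]) (auto intro!: chain)
  have "defect (t + s + r) \<le> ?d 0 + ?d 1"
  proof -
    have mem0: "t + s \<in> {0..<b}" "t + s + r \<in> {0..<b}" using mem[of 0] p0 by auto
    have f0: "f (t + s) = p 1 + s" "f (t + s + r) = p 1 + s + r" using step[of 0] p0 n by auto
    have mem1: "p 1 + s \<in> {0..<b}" "p 1 + s + r \<in> {0..<b}" using mem[of 1] n by auto
    have a: "pull (sec (p 1 + s)) = sec (t + s)"
      using sec_step_inside[of "t + s"] mem0 s f0 by simp
    have b: "sec (p 1 + s + r) = sec (t + s + r)"
      using sec_step_outside[of "t + s + r"] mem0 s f0 by simp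
    have "?d 1 = meas_dist N (sec (t + s)) (pull (sec (t + s + r)))"
      using meas_dist_vimage[OF T sets_sec[OF mem1(1)] sets_sec[OF mem1(2)]] by (simp add: a b)
    then show ?thesis
      using N.meas_dist_triangle[of "sec (t + s + r)" "sec (t + s)" "pull (sec (t + s + r))"]
        sets_sec mem0 sets_pull by (simp add: defect_def p0 meas_dist_commute)
  qed
  then have "real n * defect (t + s + r) \<le> real n * ?d 0 + real n * ?d 1"
    by (metis distrib_left mult_left_mono of_nat_0_le_iff)
  also have "\<dots> \<le> (\<Sum>k\<in>{-int n..0}. ?d 0) + (\<Sum>k\<in>{1..int n}. ?d 1)"
    by (simp add: meas_dist_def mult_right_mono)
  also have "\<dots> = (\<Sum>k\<in>{-int n..0}. ?d k) + (\<Sum>k\<in>{1..int n}. ?d k)"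
    by (intro arg_cong2[where f="(+)"] sum.cong refl low[symmetric] up[symmetric])
  also have "\<dots> = (\<Sum>k\<in>{-int n..int n}. ?d k)"
  proof -
    have "{-int n..int n} = {-int n..0} \<union> {1..int n}" by auto
    then show ?thesis by (simp add: sum.union_disjoint)
  qed
  finally show ?thesis .
qed

text \<open>
  Integrate \<open>defect_le_tower_sum\<close> over \<open>s\<close>. The second bound, from the constant function \<open>1\<close> in
  place of the distance, forces towers of height \<open>n\<close> to have radius at most \<open>b / n\<close>.
\<close>

lemma tower_estimate:
  assumes tower: "translation_tower b f n r p" and p0: "p 0 = t" and n: "1 \<le> n" and r: "0 < r"
    and q: "0 \<le> q" "AE y in leb_on b. q < defect y"
  shows "real n * q * r \<le> measure Q (shift_diff b r family)" "real n * r \<le> b"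
proof -
  let ?K = "{-int n..int n}"
  interpret Q: finite_measure Q by (rule finite_measure_Q)
  interpret NL: pair_sigma_finite N "leb_on b" ..
  let ?S = "shift_diff b r family"
  let ?h = "\<lambda>y. emeasure N ((\<lambda>x. (x, y)) -` ?S)"
  have S: "?S \<in> sets Q" using r by (intro sets_shift_diff sets_family) simp
  have h: "?h \<in> borel_measurable (leb_on b)"
    by (rule NL.measurable_emeasure_Pair2[OF S])
  have mem: "p k + s \<in> {0..<b}" if "k \<in> ?K" "\<bar>s\<bar> < r" for k s
    using translation_towerD(1)[OF tower that] .
  have sep: "r \<le> \<bar>p j - p k\<bar>" if "j \<in> ?K" "k \<in> ?K" "j \<noteq> k" for j k
  proof -
    have "2 * r \<le> \<bar>p j - p k\<bar>" using translation_towerD(3)[OF tower that] .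
    then show ?thesis using r by simp
  qed
  have h_eq: "?h (p k + s) = ennreal (meas_dist N (sec (p k + s)) (sec (p k + s + r)))"
    if k: "k \<in> ?K" and s: "-r < s" "s < 0" for k s
  proof -
    have "p k + s \<in> {0..<b}" "p k + s + r \<in> {0..<b}" using mem[OF k, of s] mem[OF k, of "s + r"] s by (auto simp: add.assoc)
    then have "(\<lambda>x. (x, p k + s)) -` ?S = (sec (p k + s) - sec (p k + s + r)) \<union> (sec (p k + s + r) - sec (p k + s))"
      by (auto simp: shift_diff_def family_def)
    then show ?thesis by (simp add: meas_dist_def N.emeasure_eq_measure)
  qed
  have "AE y in lebesgue. y \<in> {0..<b} \<longrightarrow> q < defect y"
    using q(2) unfolding leb_on_def by (subst (asm) AE_restrict_space_iff) auto
  from measure_preserving_AE[OF measure_preserving_lebesgue_translation this, of "t + r"]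
  have "AE s in lebesgue. s + (t + r) \<in> {0..<b} \<longrightarrow> q < defect (s + (t + r))" .
  then have "AE s in lebesgue. -r < s \<and> s < 0 \<longrightarrow> ennreal (real n * q) \<le> (\<Sum>k\<in>?K. ?h (p k + s))"
  proof eventually_elim
    case (elim s)
    show ?case
    proof
      assume s: "-r < s \<and> s < 0"
      have "s + (t + r) \<in> {0..<b}" using mem[of 0 "s + r"] s p0 by (auto simp: algebra_simps)
      then have "q \<le> defect (t + s + r)" using elim by (simp add: algebra_simps)
      then have "real n * q \<le> real n * defect (t + s + r)" by (simp add: mult_left_mono)
      also have "\<dots> \<le> (\<Sum>k\<in>?K. meas_dist N (sec (p k + s)) (sec (p k + s + r)))"
        using s by (intro defect_le_tower_sum[OF tower p0 n]) auto
      finally have "ennreal (real n * q) \<le> ennreal (\<Sum>k\<in>?K. meas_dist N (sec (p k + s)) (sec (p k + s + r)))"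
        by (rule ennreal_leI)
      also have "\<dots> = (\<Sum>k\<in>?K. ennreal (meas_dist N (sec (p k + s)) (sec (p k + s + r))))"
        by (rule sum_ennreal[symmetric]) (simp add: meas_dist_def)
      also have "\<dots> = (\<Sum>k\<in>?K. ?h (p k + s))"
        using s by (intro sum.cong refl h_eq[symmetric]) auto
      finally show "ennreal (real n * q) \<le> (\<Sum>k\<in>?K. ?h (p k + s))" .
    qed
  qed
  then have "ennreal (real n * q * r) \<le> (\<integral>\<^sup>+y. ?h y \<partial>leb_on b)"
    using q mem sep by (intro separated_translates_integral[OF h r, of ?K p]) auto
  also have "\<dots> = emeasure Q ?S"
    by (rule NL.emeasure_pair_measure_alt2[OF S, symmetric])
  finally show "real n * q * r \<le> measure Q ?S"
    by (simp add: Q.emeasure_eq_measure)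
  have "ennreal (real n * r) \<le> (\<integral>\<^sup>+y. 1 \<partial>leb_on b)"
  proof (rule separated_translates_integral[OF _ r, of _ _ ?K p])
    have "ennreal (real n) \<le> of_nat (card ?K)"
      unfolding ennreal_of_nat_eq_real_of_nat by (intro ennreal_leI) simp
    then show "AE s in lebesgue. -r < s \<and> s < 0 \<longrightarrow> ennreal (real n) \<le> (\<Sum>k\<in>?K. 1)"
      by simp
  qed (use mem sep in auto)
  also have "\<dots> = ennreal b"
    using t by (simp add: emeasure_leb_on)
  finally show "real n * r \<le> b" using t by simp
qed

text \<open>
  A positive lower bound \<open>q\<close> of the defect would keep the measure of \<open>shift_diff\<close> above
  \<open>n q r \<ge> c q\<close> for arbitrarily small \<open>r\<close>.
\<close>

lemma defect_zero:
  assumes iet: "iet b f" and psi: "0 < psi b f t"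
  shows "AE y in leb_on b. defect y = 0"
proof (rule ccontr)
  assume contra: "\<not> (AE y in leb_on b. defect y = 0)"
  have "\<exists>q>0. AE y in leb_on b. q < defect y"
  proof (rule ccontr)
    assume no: "\<not> (\<exists>q>0. AE y in leb_on b. q < defect y)"
    have "AE y in leb_on b. defect y \<le> 1 / Suc j" for j
    proof -
      let ?q = "1 / real (Suc j)"
      have "(AE y in leb_on b. ?q < defect y) \<or> (AE y in leb_on b. \<not> ?q < defect y)"
      proof (rule ergodic_dichotomy[OF f])
        show "{y \<in> space (leb_on b). ?q < defect y} \<in> sets (leb_on b)"
          using measurable_defect by measurable
      qed (simp add: defect_invariant)
      moreover have "0 < ?q" by simp
      ultimately have "AE y in leb_on b. \<not> ?q < defect y" using no by blast
      then show ?thesis by (simp only: not_less)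
    qed
    then have "AE y in leb_on b. \<forall>j. defect y \<le> 1 / Suc j" by (simp add: AE_all_countable)
    then have "AE y in leb_on b. defect y = 0"
    proof eventually_elim
      case (elim y)
      have "defect y \<le> 0"
      proof (rule ccontr)
        assume "\<not> defect y \<le> 0"
        then obtain j where "inverse (real (Suc j)) < defect y" using reals_Archimedean[of "defect y"] by auto
        then show False using elim[rule_format, of j] by (simp add: inverse_eq_divide)
      qed
      then show ?case by (simp add: defect_def meas_dist_def measure_le_0_iff)
    qed
    then show False using contra by blast
  qed
  then obtain q where q: "0 < q" "AE y in leb_on b. q < defect y" by blast
  obtain c where c: "0 < c" "\<exists>\<^sub>F n in sequentially. c < real n * rho'_n b f n t"
    using psi_pos_frequently[OF psi] by blast
  obtain d where d: "0 < d" "\<And>r. 0 \<le> r \<and> r < d \<Longrightarrow> measure Q (shift_diff b r family) \<le> c * q / 2"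
    using small_shift_diff[OF sets_family] c(1) q(1) by (metis half_gt_zero mult_pos_pos)
  \<comment> \<open>Beyond this height the radius is below \<open>d\<close>, by the second part of \<open>tower_estimate\<close>.\<close>
  obtain m where m: "b / d < real m" using reals_Archimedean2 by blast
  obtain n where n: "max 1 m \<le> n" "c < real n * rho'_n b f n t"
    using c(2) unfolding frequently_sequentially by blast
  let ?r = "rho'_n b f n t"
  have n1: "1 \<le> n" "m \<le> n" using n(1) by auto
  have r: "0 < ?r" using n(2) c(1) by (metis less_trans of_nat_0_le_iff zero_less_mult_pos2 not_less mult_nonneg_nonpos)
  have tower: "translation_tower b f n ?r (\<lambda>k. int_iterate b f k t)"
    using t by (intro rho'_n_tower[OF iet _ n1(1) r]) simp
  note est = tower_estimate[OF tower _ n1(1) r _ q(2)]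
  have p0: "int_iterate b f 0 t = t" by (simp add: int_iterate_def)
  have "b < real n * d"
  proof -
    have "b < real m * d" using m d(1) by (simp add: field_simps)
    also have "\<dots> \<le> real n * d" using n1(2) d(1) by (intro mult_right_mono) auto
    finally show ?thesis .
  qed
  then have "real n * ?r < real n * d" using est(2)[OF p0] q(1) by simp
  then have "?r < d" using n1(1) by simp
  then have "real n * q * ?r \<le> c * q / 2"
    using est(1)[OF p0] q(1) d(2)[of ?r] r by linarith
  moreover have "c * q < real n * q * ?r" using mult_strict_right_mono[OF n(2) q(1)] by (simp add: mult_ac)
  ultimately show False using mult_pos_pos[OF c(1) q(1)] by simp
qed

section \<open>Ergodicity of the square of the induced map\<close>

lemma sec_inside: "y \<in> {0..<t} \<Longrightarrow> sec y = (\<lambda>x. (x, y)) -` E"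
  using sets.sets_into_space[OF E] by (auto simp: sec_def e_id space_pair_measure space_N)

lemma measure_sec_invariant:
  assumes y: "y \<in> {0..<t}"
  shows "measure N (sec (T y)) = measure N (sec y)"
proof -
  have "y \<in> {0..<b}" using y t by auto
  have "sec (T y) = sec (f y)"
    using T_mem[OF y] y by (simp add: sec_def e_id e_in)
  moreover have "emeasure N (pull (sec (f y))) = emeasure N (sec (f y))"
    by (rule measure_preserving_emeasure_vimage[OF T sets_sec[OF f_mem[OF \<open>y \<in> {0..<b}\<close>]]])
  ultimately show ?thesis
    by (simp only: measure_def sec_step_inside[OF y])
qed

text \<open>
  Almost every section is null or full because \<open>T\<close> is ergodic; which of the two occurs does not depend on the
  section, because its measure is a \<open>T\<close>-invariant function.
\<close>

lemma trivial_if_defect_zero: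
  assumes erg: "ergodic N T" and AE: "AE y in N. defect y = 0"
  shows "emeasure (N \<Otimes>\<^sub>M N) E = 0 \<or> emeasure (N \<Otimes>\<^sub>M N) (space (N \<Otimes>\<^sub>M N) - E) = 0"
proof -
  interpret NN: pair_prob_space N N ..
  have zero_one: "AE y in N. measure N (sec y) = 0 \<or> measure N (sec y) = 1"
    using AE AE_space
  proof eventually_elim
    case (elim y)
    then have y: "y \<in> {0..<t}" "y \<in> {0..<b}" using t by (auto simp: space_N)
    note S = sets_sec[OF y(2)] sets_pull[OF sets_sec[OF y(2)]]
    have "(sec y - pull (sec y)) \<union> (pull (sec y) - sec y) \<in> null_sets N"
      using elim(1) S by (auto simp: defect_def meas_dist_def null_sets_def N.emeasure_eq_measure)
    then have "AE x in N. x \<notin> (sec y - pull (sec y)) \<union> (pull (sec y) - sec y)"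
      by (rule AE_not_in)
    then have "AE x in N. T x \<in> sec y \<longleftrightarrow> x \<in> sec y"
      using AE_space by eventually_elim auto
    then have "(AE x in N. x \<in> sec y) \<or> (AE x in N. x \<notin> sec y)"
      by (rule ergodic_dichotomy_AE[OF erg S(1)])
    then show ?case
      using N.prob_eq_1[OF S(1)] N.prob_eq_0[OF S(1)] by blast
  qed
  have sec_meas: "(\<lambda>y. emeasure N ((\<lambda>x. (x, y)) -` E)) \<in> borel_measurable N"
    by (rule NN.measurable_emeasure_Pair2[OF E])
  have sec_eq: "emeasure N ((\<lambda>x. (x, y)) -` E) = ennreal (measure N (sec y))" if "y \<in> space N" for y
    using sec_inside[of y] that by (simp add: space_N N.emeasure_eq_measure)
  have "{y \<in> space N. measure N (sec y) = 0} = {y \<in> space N. emeasure N ((\<lambda>x. (x, y)) -` E) = 0}"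
    using sec_eq by auto
  also have "\<dots> \<in> sets N" using sec_meas by measurable
  finally have "(AE y in N. measure N (sec y) = 0) \<or> (AE y in N. \<not> measure N (sec y) = 0)"
    by (intro ergodic_dichotomy[OF erg]) (auto simp: measure_sec_invariant space_N)
  then show ?thesis
  proof
    assume "AE y in N. measure N (sec y) = 0"
    then have "AE y in N. emeasure N ((\<lambda>x. (x, y)) -` E) = 0"
      using AE_space by eventually_elim (simp add: sec_eq)
    then have "emeasure (N \<Otimes>\<^sub>M N) E = 0"
      using nn_integral_0_iff_AE[OF sec_meas] by (simp add: NN.emeasure_pair_measure_alt2[OF E])
    then show ?thesis ..
  next
    assume "AE y in N. \<not> measure N (sec y) = 0"
    with zero_one have "AE y in N. emeasure N ((\<lambda>x. (x, y)) -` E) = 1"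
      using AE_space by eventually_elim (simp add: sec_eq)
    then have "emeasure (N \<Otimes>\<^sub>M N) E = (\<integral>\<^sup>+y. 1 \<partial>N)"
      unfolding NN.emeasure_pair_measure_alt2[OF E] by (rule nn_integral_cong_AE)
    then have "NN.prob E = 1" by (simp add: N.emeasure_space_1 measure_def)
    then have "NN.prob (space (N \<Otimes>\<^sub>M N) - E) = 0" by (simp add: NN.prob_compl[OF E])
    then show ?thesis by (simp add: NN.emeasure_eq_measure)
  qed
qed

end

theorem theorem2:
  fixes b t :: real and f :: "real \<Rightarrow> real"
  assumes "iet b f"
    and "ergodic (leb_on b) f"
    and "t \<in> {0<..<b}"
    and "psi b f t > 0"
  shows "weakly_mixing (normalized_leb_on t) (first_return_map f t)"
proof -
  define N where "N = normalized_leb_on t"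
  define T where "T = first_return_map f t"
  let ?Y = "{0..<t}"
  have t: "0 < t" "t < b" using assms(3) by auto
  have T_eq: "T = return_map f ?Y" by (simp add: T_def first_return_map_def return_map_def fun_eq_iff)
  have leb_t: "restrict_space (leb_on b) ?Y = leb_on t"
    using t by (simp add: leb_on_def restrict_restrict_space Int_absorb1)
  have N_eq: "N = uniform_measure (leb_on t) (space (leb_on t))"
    by (simp add: N_def normalized_leb_on_def)
  have Y: "?Y \<in> sets (leb_on b)" "?Y \<noteq> {}" using t by (auto simp: sets_leb_on_iff)
  have return: "\<exists>n\<ge>1. (f ^^ n) y \<in> ?Y" if "y \<in> ?Y" for y
    by (rule iet_returns[OF assms(1) t(2) that])
  have erg: "ergodic N T"
    using return_map_ergodic[OF finite_measure_leb_on assms(2) Y return]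
    unfolding leb_t N_eq T_eq by (rule ergodic_uniform_measure)
  then have mp: "measure_preserving_map N T" by (simp add: ergodic_def)
  have "emeasure (leb_on t) (space (leb_on t)) \<noteq> 0" using t by (simp add: emeasure_leb_on)
  then interpret N: prob_space N
    unfolding N_eq by (rule prob_space_uniform_measure_space[OF finite_measure_leb_on])
  have space_N: "space N = ?Y" and sets_N: "sets N = sets (leb_on t)" by (simp_all add: N_eq)
  have f: "f \<in> measurable (leb_on b) (leb_on b)"
    using assms(2) unfolding ergodic_def measure_preserving_map_def by blast
  define e where "e = entry_map f ?Y 0"
  have e: "e \<in> measurable (leb_on b) N"
    unfolding e_def using measurable_entry_map[OF f Y(1), of 0] t
    by (simp add: leb_t measurable_cong_sets[OF refl sets_N])
  have "ergodic (N \<Otimes>\<^sub>M N) (map_prod T T)"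
    unfolding ergodic_def
  proof (intro conjI ballI impI)
    show "measure_preserving_map (N \<Otimes>\<^sub>M N) (map_prod T T)"
      by (rule measure_preserving_map_prod[OF N.sigma_finite_measure_axioms mp])
    fix E assume E: "E \<in> sets (N \<Otimes>\<^sub>M N)" and inv: "map_prod T T -` E \<inter> space (N \<Otimes>\<^sub>M N) = E"
    interpret skew_sections N b t f T e E
    proof
      fix y assume y: "y \<in> ?Y"
      show "e (f y) = T y" unfolding e_def T_eq by (rule entry_map_step_inside[OF return[OF y]])
      show "e y = y" unfolding e_def by (rule entry_map_inside[OF y])
    next
      fix y assume "y \<in> {0..<b}" "y \<notin> ?Y"
      then show "e (f y) = e y" unfolding e_def by (intro entry_map_step_outside)
    next
      fix x y assume "x \<in> ?Y" "y \<in> ?Y"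
      then have "(x, y) \<in> space (N \<Otimes>\<^sub>M N)" by (simp add: space_pair_measure space_N)
      then have "(x, y) \<in> E \<longleftrightarrow> map_prod T T (x, y) \<in> E" using inv by blast
      then show "(T x, T y) \<in> E \<longleftrightarrow> (x, y) \<in> E" by simp
    qed (use t space_N mp assms(2) e E in auto)
    have "AE y in leb_on b. defect y = 0"
      by (rule defect_zero[OF assms(1,4)])
    then have "AE y in leb_on t. defect y = 0"
      unfolding leb_t[symmetric] using Y(1) t
      by (subst AE_restrict_space_iff) (auto simp: min_absorb1 min_absorb2)
    then have "AE y in N. defect y = 0"
      unfolding N_eq by (intro AE_uniform_measureI[OF sets.top]) (auto elim: eventually_mono)
    then show "emeasure (N \<Otimes>\<^sub>M N) E = 0 \<or> emeasure (N \<Otimes>\<^sub>M N) (space (N \<Otimes>\<^sub>M N) - E) = 0"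
      by (rule trivial_if_defect_zero[OF erg])
  qed
  then show ?thesis
    using N.weakly_mixing_if_ergodic_square[OF mp] by (simp add: N_def T_def)
qed

end
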